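(* There is a universal constant $C>0$ such that the following holds. For any $0\le\phi\le 1$ and any two permutations $\pi^*,\sigma^*$ on $[n]$ with $\|v_{\pi^*}-v_{\sigma^*}\|\le\frac{1}{2(1-\phi)}$ (interpreted as $+\infty$ when $\phi=1$), $$D_{\mathrm{TV}}\big(M(\phi,\pi^* ),M(\phi,\sigma^* )\big)\ge\frac{(1-\phi)\,\|v_{\pi^*}-v_{\sigma^*}\|}{C}.$$
   Context: For a permutation $\pi$ on $[n]$, $\pi^{-1}(i)$ denotes the position of element $i$. The Kendall-tau distance $d_{\mathrm{KT}}(\pi,\sigma)$ is the number of pairs of elements whose relative order in $\pi$ differs from that in $\sigma$. The Mallows model $M(\phi,\pi^* )$ on $[n]$ is the distribution on permutations with $\Pr[\pi]\propto\phi^{d_{\mathrm{KT}}(\pi,\pi^* )}$ (with $0^0=1$). The position vector is $v_\pi=(\pi^{-1}(1),\dots,\pi^{-1}(n))\in\mathbb R^n$; $\|\cdot\|$ is the Euclidean norm and $D_{\mathrm{TV}}$ is total variation distance. *)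

theory Defs
  imports "HOL-Probability.Probability" "HOL-Combinatorics.Permutations"
begin

text \<open>
  A permutation of \<open>[n]\<close> is a function \<open>\<pi>\<close> with \<open>\<pi> permutes {1..n}\<close>, mapping a position to the
  element at that position; \<open>inv \<pi> i\<close> is the position of the element \<open>i\<close>. Each unordered pair of
  elements is counted once in the Kendall-tau distance, as \<open>(i, j)\<close> with \<open>i < j\<close>.
\<close>

definition kendall_tau :: "nat \<Rightarrow> (nat \<Rightarrow> nat) \<Rightarrow> (nat \<Rightarrow> nat) \<Rightarrow> nat" where
  "kendall_tau n \<pi> \<sigma> =
     card {(i, j). i \<in> {1..n} \<and> j \<in> {1..n} \<and> i < j \<and>
                   (inv \<pi> i < inv \<pi> j) \<noteq> (inv \<sigma> i < inv \<sigma> j)}"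

definition mallows_Z :: "nat \<Rightarrow> real \<Rightarrow> (nat \<Rightarrow> nat) \<Rightarrow> real" where
  "mallows_Z n \<phi> \<pi>s = (\<Sum>\<pi> | \<pi> permutes {1..n}. \<phi> ^ kendall_tau n \<pi> \<pi>s)"

definition mallows :: "nat \<Rightarrow> real \<Rightarrow> (nat \<Rightarrow> nat) \<Rightarrow> (nat \<Rightarrow> nat) pmf" where
  "mallows n \<phi> \<pi>s = embed_pmf
     (\<lambda>\<pi>. if \<pi> permutes {1..n} then \<phi> ^ kendall_tau n \<pi> \<pi>s / mallows_Z n \<phi> \<pi>s else 0)"

lemma mallows_Z_pos:
  assumes "0 \<le> \<phi>" "\<pi>s permutes {1..n}"
  shows "mallows_Z n \<phi> \<pi>s > 0"
  unfolding mallows_Z_def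
proof (rule sum_pos2[where i = \<pi>s])
  show "finite {\<pi>. \<pi> permutes {1..n}}"
    by (simp add: finite_permutations)
  show "0 < \<phi> ^ kendall_tau n \<pi>s \<pi>s"
    by (simp add: kendall_tau_def)
qed (use assms in auto)

lemma pmf_mallows:
  assumes "0 \<le> \<phi>" "\<pi>s permutes {1..n}"
  shows "pmf (mallows n \<phi> \<pi>s) \<pi> =
    (if \<pi> permutes {1..n} then \<phi> ^ kendall_tau n \<pi> \<pi>s / mallows_Z n \<phi> \<pi>s else 0)"
  unfolding mallows_def
proof (rule pmf_embed_pmf)
  let ?f = "\<lambda>\<pi>. if \<pi> permutes {1..n} then \<phi> ^ kendall_tau n \<pi> \<pi>s / mallows_Z n \<phi> \<pi>s else 0"
  note Z = mallows_Z_pos[OF assms]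
  show nonneg: "0 \<le> ?f x" for x
    using assms Z by simp
  have fin: "finite {\<pi>. \<pi> permutes {1..n}}"
    by (simp add: finite_permutations)
  have "(\<integral>\<^sup>+x. ennreal (?f x) \<partial>count_space UNIV) = (\<Sum>x | x permutes {1..n}. ennreal (?f x))"
    by (rule nn_integral_count_space'[OF fin]) auto
  also have "\<dots> = ennreal (\<Sum>x | x permutes {1..n}. ?f x)"
    by (rule sum_ennreal) (rule nonneg)
  also have "(\<Sum>x | x permutes {1..n}. ?f x) =
      (\<Sum>x | x permutes {1..n}. \<phi> ^ kendall_tau n x \<pi>s / mallows_Z n \<phi> \<pi>s)"
    by (rule sum.cong) auto
  also have "\<dots> = mallows_Z n \<phi> \<pi>s / mallows_Z n \<phi> \<pi>s"
    by (simp only: mallows_Z_def sum_divide_distrib)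
  also have "\<dots> = 1"
    using Z by simp
  finally show "(\<integral>\<^sup>+x. ennreal (?f x) \<partial>count_space UNIV) = 1"
    by simp
qed

definition tv_dist :: "'a pmf \<Rightarrow> 'a pmf \<Rightarrow> real" where
  "tv_dist p q = (SUP A. \<bar>measure_pmf.prob p A - measure_pmf.prob q A\<bar>)"

lemma bdd_above_tv_dist:
  "bdd_above (range (\<lambda>A. \<bar>measure_pmf.prob p A - measure_pmf.prob q A\<bar>))"
proof (rule bdd_aboveI2)
  show "\<bar>measure_pmf.prob p A - measure_pmf.prob q A\<bar> \<le> 1" for A
    using measure_pmf.prob_le_1[of p A] measure_pmf.prob_le_1[of q A]
      measure_nonneg[of "measure_pmf p" A] measure_nonneg[of "measure_pmf q" A]
    by linarith
qed

text \<open>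
  As \<open>n\<close> is not fixed, vectors in \<open>\<real>\<^sup>n\<close> are functions on \<open>{1..n}\<close> and \<^const>\<open>L2_set\<close> over \<open>{1..n}\<close> is
  their Euclidean norm.
\<close>

definition pos_vec :: "(nat \<Rightarrow> nat) \<Rightarrow> nat \<Rightarrow> real" where
  "pos_vec \<pi> i = real (inv \<pi> i)"

definition pos_vec_dist :: "nat \<Rightarrow> (nat \<Rightarrow> nat) \<Rightarrow> (nat \<Rightarrow> nat) \<Rightarrow> real" where
  "pos_vec_dist n \<pi> \<sigma> = L2_set (\<lambda>i. pos_vec \<pi> i - pos_vec \<sigma> i) {1..n}"

end

theory Submission
  imports Defs
begin

text \<open>
  Write \<open>\<delta> = 1 - \<phi>\<close>, let \<open>P\<close>, \<open>Q\<close> be the two Mallows distributions, \<open>D\<close> the distance of the position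
  vectors and \<open>T \<pi>\<close> the Kendall-tau distance of \<open>\<pi>\<close> to \<open>\<sigma>\<^sup>*\<close> minus that to \<open>\<pi>\<^sup>*\<close>. As \<open>Q = P \<phi>\<^sup>T\<close>, the
  density \<open>\<bar>P - Q\<bar> / (P + Q)\<close> is comparable to \<open>min 1 (\<delta> \<bar>T\<bar>)\<close>, so it suffices that \<open>\<bar>T\<bar>\<close> has size at
  least of order \<open>D\<close> with constant probability under \<open>P + Q\<close>. This follows from a second moment bound
  from below and a fourth moment bound from above.

  Second moment: \<open>T\<close> is a sum of signs over the discordant pairs of \<open>\<pi>\<^sup>*\<close> and \<open>\<sigma>\<^sup>*\<close>. Exchanging \<open>i\<close> and
  \<open>j\<close> shows that the sign of a pair at distance \<open>d\<close> has \<open>P\<close>-mean at least \<open>\<delta> d / 9\<close>, and the distances of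
  all discordant pairs add up to exactly \<open>D\<^sup>2 / 2\<close>. Hence \<open>E\<^sub>P T - E\<^sub>Q T\<close> is at least of order \<open>\<delta> D\<^sup>2\<close>, while
  it is at most \<open>\<delta>\<close> times the second moment of \<open>T\<close> under \<open>P + Q\<close>.

  Fourth moment: the entries of the Lehmer code are independent truncated geometric variables. In the
  martingale that reveals them one at a time, the \<open>k\<close>-th increment of the conditional mean of \<open>T\<close> is
  bounded by a constant \<open>c\<^sub>k\<close>, and counting discordant pairs and Hardy's inequality give
  \<open>\<Sum> c\<^sub>k\<^sup>2 = O(D\<^sup>2)\<close>.
\<close>

section \<open>Truncated geometric variables\<close>

text \<open>The term linear in \<open>d\<close> averages to zero. In the fourth power the cubic term
  is absorbed by subtracting a square, which raises the coefficient of
  \<open>M\<^sup>2 * x\<^sup>2\<close> from 6 to 8. The constants 8 and 4 are those with which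
  \<open>martingale_moments\<close> completes a square.\<close>

lemma average_power_bounds:
  assumes "finite U" "\<And>u. u \<in> U \<Longrightarrow> p u \<ge> (0::real)" "sum p U = 1"
    and "(\<Sum>u\<in>U. p u * d u) = 0" "\<And>u. u \<in> U \<Longrightarrow> \<bar>d u\<bar> \<le> c"
  shows "(\<Sum>u\<in>U. p u * (M + d u)\<^sup>2) \<le> M\<^sup>2 + c\<^sup>2"
    and "(\<Sum>u\<in>U. p u * (M + d u) ^ 4) \<le> M ^ 4 + 8 * c\<^sup>2 * M\<^sup>2 + 4 * (c\<^sup>2)\<^sup>2"
proof -
  have "p u * (M + d u)\<^sup>2 \<le> p u * (M\<^sup>2 + c\<^sup>2) + 2 * M * (p u * d u)" if "u \<in> U" for u
  proof -
    have "(d u)\<^sup>2 \<le> c\<^sup>2" using assms(5)[OF that] by (metis abs_ge_zero power2_abs power_mono)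
    then have "(M + d u)\<^sup>2 \<le> M\<^sup>2 + c\<^sup>2 + 2 * M * d u" by (simp add: power2_sum)
    from mult_left_mono[OF this assms(2)[OF that]] show ?thesis by (simp add: algebra_simps)
  qed
  then have "(\<Sum>u\<in>U. p u * (M + d u)\<^sup>2) \<le> (\<Sum>u\<in>U. p u * (M\<^sup>2 + c\<^sup>2) + 2 * M * (p u * d u))"
    by (rule sum_mono)
  also have "\<dots> = M\<^sup>2 + c\<^sup>2"
    using assms by (simp add: sum.distrib flip: sum_distrib_left sum_distrib_right)
  finally show "(\<Sum>u\<in>U. p u * (M + d u)\<^sup>2) \<le> M\<^sup>2 + c\<^sup>2" .
  have "p u * (M + d u) ^ 4 \<le> p u * (M ^ 4 + 8 * c\<^sup>2 * M\<^sup>2 + 4 * (c\<^sup>2)\<^sup>2) + 4 * M ^ 3 * (p u * d u)" if "u \<in> U" for u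
  proof -
    define x where "x = d u"
    have x: "x\<^sup>2 \<le> c\<^sup>2" using assms(5)[OF that] unfolding x_def by (metis abs_ge_zero power2_abs power_mono)
    have "M\<^sup>2 * x\<^sup>2 \<le> M\<^sup>2 * c\<^sup>2" using x by (intro mult_left_mono) auto
    moreover have "(x\<^sup>2)\<^sup>2 \<le> (c\<^sup>2)\<^sup>2" by (rule power_mono[OF x]) simp
    moreover have "(M + x) ^ 4 = M ^ 4 + 4 * M ^ 3 * x + 8 * (M\<^sup>2 * x\<^sup>2) + 3 * (x\<^sup>2)\<^sup>2 - 2 * (x * (M - x))\<^sup>2"
      by (simp add: power2_eq_square power3_eq_cube power4_eq_xxxx algebra_simps)
    moreover have "(x * (M - x))\<^sup>2 \<ge> 0" "(x\<^sup>2)\<^sup>2 \<ge> 0" by simp_all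
    ultimately have "(M + x) ^ 4 \<le> M ^ 4 + 8 * (M\<^sup>2 * c\<^sup>2) + 4 * (c\<^sup>2)\<^sup>2 + 4 * M ^ 3 * x"
      by linarith
    then have "(M + x) ^ 4 \<le> M ^ 4 + 8 * c\<^sup>2 * M\<^sup>2 + 4 * (c\<^sup>2)\<^sup>2 + 4 * M ^ 3 * x"
      by (simp only: mult.commute[of "M\<^sup>2"] mult.assoc)
    from mult_left_mono[OF this assms(2)[OF that]] show ?thesis by (simp add: algebra_simps x_def)
  qed
  then have "(\<Sum>u\<in>U. p u * (M + d u) ^ 4) \<le>
     (\<Sum>u\<in>U. p u * (M ^ 4 + 8 * c\<^sup>2 * M\<^sup>2 + 4 * (c\<^sup>2)\<^sup>2) + 4 * M ^ 3 * (p u * d u))"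
    by (rule sum_mono)
  also have "\<dots> = M ^ 4 + 8 * c\<^sup>2 * M\<^sup>2 + 4 * (c\<^sup>2)\<^sup>2"
    using assms by (simp add: sum.distrib flip: sum_distrib_left sum_distrib_right)
  finally show "(\<Sum>u\<in>U. p u * (M + d u) ^ 4) \<le> M ^ 4 + 8 * c\<^sup>2 * M\<^sup>2 + 4 * (c\<^sup>2)\<^sup>2" .
qed

locale subunit =
  fixes \<phi> :: real
  assumes phi_nonneg: "0 \<le> \<phi>" and phi_less_1: "\<phi> < 1"
begin

definition geom_wt :: "nat \<Rightarrow> nat \<Rightarrow> real" where
  "geom_wt k u = \<phi> ^ u / (\<Sum>u<k. \<phi> ^ u)"

definition codes :: "nat \<Rightarrow> (nat \<Rightarrow> nat) set" where
  "codes n = (\<Pi>\<^sub>E k\<in>{1..n}. {..<k})"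

text \<open>Expectation for independent entries, the \<open>k\<close>-th one distributed with
  weights \<open>geom_wt k\<close>.\<close>

definition code_expect :: "nat \<Rightarrow> ((nat \<Rightarrow> nat) \<Rightarrow> real) \<Rightarrow> real" where
  "code_expect n F = (\<Sum>v\<in>codes n. (\<Prod>k\<in>{1..n}. geom_wt k (v k)) * F v)"

section \<open>Estimates for the weights and for powers of \<phi>\<close>

lemma geom_sum_pos: "k > 0 \<Longrightarrow> (\<Sum>u<k. \<phi> ^ u) > 0"
proof -
  assume "k > 0"
  then show ?thesis
    using phi_nonneg by (intro sum_pos2[where i=0]) auto
qed

lemma geom_wt_nonneg: "geom_wt k u \<ge> 0"
  unfolding geom_wt_def using phi_nonneg by (intro divide_nonneg_nonneg sum_nonneg) auto

lemma sum_geom_wt: "k > 0 \<Longrightarrow> (\<Sum>u<k. geom_wt k u) = 1"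
  using geom_sum_pos[of k] by (simp add: geom_wt_def flip: sum_divide_distrib)

lemma geom_wt_0: "k > 0 \<Longrightarrow> geom_wt k 0 = (1 - \<phi>) / (1 - \<phi> ^ k)"
  using geom_sum_pos[of k] phi_less_1 by (simp add: geom_wt_def sum_gp_strict)

lemma geom_wt_le: "geom_wt k u \<le> geom_wt k 0"
  unfolding geom_wt_def using phi_nonneg phi_less_1
  by (intro divide_right_mono sum_nonneg) (auto simp: power_le_one)

text \<open>A weak form of Bernoulli's inequality for \<open>1 / \<phi>\<close>, multiplied out so
  that \<phi> = 0 is covered.\<close>

lemma power_le_inverse: "\<phi> ^ k * (1 + real k * (1 - \<phi>)) \<le> 1"
proof (induction k)
  case (Suc k)
  have "\<phi> * (1 + real (Suc k) * (1 - \<phi>)) \<le> 1 + real k * (1 - \<phi>)"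
  proof -
    have "1 + real k * (1 - \<phi>) - \<phi> * (1 + real (Suc k) * (1 - \<phi>))
        = (1 - \<phi>)\<^sup>2 * (1 + real k)"
      by (simp add: algebra_simps power2_eq_square)
    also have "\<dots> \<ge> 0" by simp
    finally show ?thesis by simp
  qed
  then have "\<phi> ^ k * (\<phi> * (1 + real (Suc k) * (1 - \<phi>))) \<le> \<phi> ^ k * (1 + real k * (1 - \<phi>))"
    using phi_nonneg by (intro mult_left_mono) auto
  with Suc show ?case by (simp add: mult.assoc mult.left_commute)
qed simp

text \<open>Together with \<open>one_minus_power_le\<close> this makes \<open>1 - \<phi> ^ k\<close>
  comparable to the minimum of 1 and \<delta> k.\<close>

lemma one_minus_power_ge:
  "1 - \<phi> ^ k \<ge> (1 - \<phi>) * real k / (1 + (1 - \<phi>) * real k)"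
proof -
  have "1 + (1 - \<phi>) * real k > 0" using phi_less_1 by (intro add_pos_nonneg) auto
  then show ?thesis using power_le_inverse[of k]
    by (simp add: field_simps)
qed

lemma one_minus_power_le: "1 - \<phi> ^ k \<le> (1 - \<phi>) * real k"
  using Bernoulli_inequality[of "\<phi> - 1" k] phi_nonneg by (simp add: algebra_simps)

lemma geom_wt_0_le: "k > 0 \<Longrightarrow> geom_wt k 0 \<le> (1 - \<phi>) + 1 / real k"
proof -
  assume k: "k > 0"
  have pos: "\<phi> ^ k < 1" using phi_nonneg phi_less_1 k by (simp add: power_less_one_iff)
  have p: "(1 - \<phi>) * real k > 0" using k phi_less_1 by simp
  have "(1 - \<phi>) * real k \<le> (1 - \<phi> ^ k) * (1 + (1 - \<phi>) * real k)"
    using one_minus_power_ge[of k] p by (simp add: divide_le_eq)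
  then show ?thesis using k pos by (simp add: geom_wt_0 field_simps)
qed

text \<open>As \<phi> tends to 1 the weight of 0 tends to 1/k, and (1 + 1/k) / (k + 1) = 1/k; in
  general only a factor 1 + \<delta> is lost. This closes the recursion in
  \<open>cond_sign_Lipschitz\<close>.\<close>

lemma geom_wt_0_Suc:
  assumes "k > 0"
  shows "(1 + geom_wt k 0) * geom_wt (Suc k) 0 \<le> (1 + (1 - \<phi>)) * geom_wt k 0"
proof -
  define s t where "s = \<phi> ^ k" and "t = \<phi> * s"
  have s: "0 \<le> s" "s < 1" using phi_nonneg phi_less_1 assms by (auto simp: power_less_one_iff s_def)
  then have t: "0 \<le> t" "t < 1" using phi_nonneg phi_less_1
    by (auto simp: t_def) (smt (verit) mult_left_le_one_le)
  have "(1 + (1 - \<phi>)) * (1 - t) - (1 - s + (1 - \<phi>)) = s * (1 - \<phi>)\<^sup>2"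
    by (simp add: t_def algebra_simps power2_eq_square)
  then have "(1 - s + (1 - \<phi>)) \<le> (1 + (1 - \<phi>)) * (1 - t)"
    using s by (smt (verit) mult_nonneg_nonneg zero_le_power2)
  then have "(1 - s + (1 - \<phi>)) * (1 - \<phi>) \<le> (1 + (1 - \<phi>)) * (1 - t) * (1 - \<phi>)"
    using phi_less_1 by (intro mult_right_mono) auto
  then have "(1 - s + (1 - \<phi>)) * (1 - \<phi>) / ((1 - s) * (1 - t))
     \<le> (1 + (1 - \<phi>)) * (1 - t) * (1 - \<phi>) / ((1 - s) * (1 - t))"
    using s t by (intro divide_right_mono) auto
  moreover have "(1 - s + (1 - \<phi>)) * (1 - \<phi>) / ((1 - s) * (1 - t)) = (1 + (1 - \<phi>) / (1 - s)) * ((1 - \<phi>) / (1 - t))"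
    using s t by (simp add: field_simps)
  moreover have "(1 + (1 - \<phi>)) * (1 - t) * (1 - \<phi>) / ((1 - s) * (1 - t)) = (1 + (1 - \<phi>)) * ((1 - \<phi>) / (1 - s))"
    using s t by simp
  ultimately show ?thesis
    using assms by (simp add: geom_wt_0 s_def t_def)
qed

section \<open>Expectations over random codes and moments of martingales\<close>

lemma code_expect_0: "code_expect 0 F = F (\<lambda>_. undefined)"
  by (simp add: code_expect_def codes_def)

text \<open>Tower property: the last entry is averaged first, with the earlier entries held
  fixed.\<close>

lemma code_expect_Suc: "code_expect (Suc n) F = code_expect n (\<lambda>v. \<Sum>u<Suc n. geom_wt (Suc n) u * F (v(Suc n := u)))"
proof -
  have ins: "{1..Suc n} = insert (Suc n) {1..n}" by auto
  have inj: "inj_on (\<lambda>(u, v). v(Suc n := u)) ({..<Suc n} \<times> codes n)"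
    unfolding codes_def using inj_combinator[of "Suc n" "{1..n}" "\<lambda>k. {..<k}"] by simp
  have "codes (Suc n) = (\<lambda>(u, v). v(Suc n := u)) ` ({..<Suc n} \<times> codes n)"
    unfolding codes_def ins by (subst PiE_insert_eq) simp
  then have "code_expect (Suc n) F = (\<Sum>(u, v)\<in>{..<Suc n} \<times> codes n.
      (\<Prod>k\<in>{1..Suc n}. geom_wt k ((v(Suc n := u)) k)) * F (v(Suc n := u)))"
    unfolding code_expect_def by (simp only: sum.reindex[OF inj]) (simp only: o_def case_prod_unfold)
  also have "\<dots> = (\<Sum>(u, v)\<in>{..<Suc n} \<times> codes n.
      (\<Prod>k\<in>{1..n}. geom_wt k (v k)) * (geom_wt (Suc n) u * F (v(Suc n := u))))"
  proof (intro sum.cong refl, clarify)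
    fix u v
    have "(\<Prod>k\<in>{1..n}. geom_wt k ((v(Suc n := u)) k)) = (\<Prod>k\<in>{1..n}. geom_wt k (v k))"
      by (intro prod.cong) auto
    then show "(\<Prod>k\<in>{1..Suc n}. geom_wt k ((v(Suc n := u)) k)) * F (v(Suc n := u)) =
        (\<Prod>k\<in>{1..n}. geom_wt k (v k)) * (geom_wt (Suc n) u * F (v(Suc n := u)))"
      by (simp add: ins)
  qed
  also have "\<dots> = (\<Sum>v\<in>codes n. \<Sum>u<Suc n.
      (\<Prod>k\<in>{1..n}. geom_wt k (v k)) * (geom_wt (Suc n) u * F (v(Suc n := u))))"
    by (subst sum.cartesian_product[symmetric], subst sum.swap) simp
  finally show ?thesis unfolding code_expect_def sum_distrib_left .
qed

lemma code_expect_mono: "(\<And>v. v \<in> codes n \<Longrightarrow> F v \<le> G v) \<Longrightarrow> code_expect n F \<le> code_expect n G"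
  unfolding code_expect_def by (intro sum_mono mult_left_mono prod_nonneg) (auto simp: geom_wt_nonneg)

lemma code_expect_cong: "(\<And>v. v \<in> codes n \<Longrightarrow> F v = G v) \<Longrightarrow> code_expect n F = code_expect n G"
  unfolding code_expect_def by (intro sum.cong) auto

lemma code_expect_add: "code_expect n (\<lambda>v. F v + G v) = code_expect n F + code_expect n G"
  unfolding code_expect_def by (simp add: distrib_left sum.distrib)

lemma code_expect_cmult: "code_expect n (\<lambda>v. c * F v) = c * code_expect n F"
  unfolding code_expect_def by (simp add: sum_distrib_left mult.left_commute)

lemma code_expect_const: "code_expect n (\<lambda>v. c) = c"
proof (induction n)
  case (Suc n)
  then show ?case using sum_geom_wt[of "Suc n"] by (simp add: code_expect_Suc flip: sum_distrib_right del: sum.lessThan_Suc)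
qed (simp add: code_expect_0)

text \<open>Induction over the revealed entries: \<open>code_expect_Suc\<close> conditions on the
  first \<open>k\<close> of them and \<open>average_power_bounds\<close> treats the next
  increment.\<close>

lemma martingale_moments:
  fixes F :: "nat \<Rightarrow> (nat \<Rightarrow> nat) \<Rightarrow> real"
  assumes mart: "\<And>k v. k < n \<Longrightarrow> v \<in> codes k \<Longrightarrow>
      (\<Sum>u<Suc k. geom_wt (Suc k) u * F (Suc k) (v(Suc k := u))) = F k v"
    and bnd: "\<And>k v u. k < n \<Longrightarrow> v \<in> codes k \<Longrightarrow> u < Suc k \<Longrightarrow>
      \<bar>F (Suc k) (v(Suc k := u)) - F k v\<bar> \<le> c (Suc k)"
    and m: "m = F 0 (\<lambda>_. undefined)"
  shows "code_expect n (F n) = m"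
    and "code_expect n (\<lambda>v. (F n v - m) ^ 4) \<le> 4 * (\<Sum>k\<in>{1..n}. (c k)\<^sup>2)\<^sup>2"
proof -
  have step: "(\<Sum>u<Suc k. geom_wt (Suc k) u * (F (Suc k) (v(Suc k := u)) - m)\<^sup>2) \<le> (F k v - m)\<^sup>2 + (c (Suc k))\<^sup>2"
    "(\<Sum>u<Suc k. geom_wt (Suc k) u * (F (Suc k) (v(Suc k := u)) - m) ^ 4)
      \<le> (F k v - m) ^ 4 + 8 * (c (Suc k))\<^sup>2 * (F k v - m)\<^sup>2 + 4 * ((c (Suc k))\<^sup>2)\<^sup>2"
    if k: "k < n" "v \<in> codes k" for k v
  proof -
    let ?d = "\<lambda>u. F (Suc k) (v(Suc k := u)) - F k v"
    have sq: "sum (geom_wt (Suc k)) {..<Suc k} = 1" using sum_geom_wt[of "Suc k"] by (simp del: sum.lessThan_Suc)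
    have "(\<Sum>u\<in>{..<Suc k}. geom_wt (Suc k) u * ?d u) = 0"
      using mart[OF k] sq by (simp add: right_diff_distrib sum_subtractf del: sum.lessThan_Suc flip: sum_distrib_right)
    note * = average_power_bounds[where U="{..<Suc k}" and d="?d" and c="c (Suc k)" and M="F k v - m" and p="geom_wt (Suc k)",
        OF finite_lessThan geom_wt_nonneg sq this bnd[OF k]]
    show "(\<Sum>u<Suc k. geom_wt (Suc k) u * (F (Suc k) (v(Suc k := u)) - m)\<^sup>2) \<le> (F k v - m)\<^sup>2 + (c (Suc k))\<^sup>2"
      using *(1) by (simp del: sum.lessThan_Suc)
    show "(\<Sum>u<Suc k. geom_wt (Suc k) u * (F (Suc k) (v(Suc k := u)) - m) ^ 4)
      \<le> (F k v - m) ^ 4 + 8 * (c (Suc k))\<^sup>2 * (F k v - m)\<^sup>2 + 4 * ((c (Suc k))\<^sup>2)\<^sup>2"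
      using *(2) by (simp del: sum.lessThan_Suc)
  qed
  \<comment> \<open>The second moment is carried along because the fourth moment step uses it: with
    \<open>s\<close> bounding the second moment, 4 s^2 + 8 a s + 4 a^2 is the square that is
    wanted.\<close>
  have "k \<le> n \<Longrightarrow> code_expect k (F k) = m \<and> code_expect k (\<lambda>v. (F k v - m)\<^sup>2) \<le> (\<Sum>k\<in>{1..k}. (c k)\<^sup>2) \<and>
    code_expect k (\<lambda>v. (F k v - m) ^ 4) \<le> 4 * (\<Sum>k\<in>{1..k}. (c k)\<^sup>2)\<^sup>2" for k
  proof (induction k)
    \<comment> \<open>\<open>codes 0\<close> contains only the function that is
      \<open>undefined\<close> everywhere, and there \<open>F 0\<close> equals
      \<open>m\<close>.\<close>
    case 0 then show ?case by (simp add: code_expect_0 m)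
  next
    case (Suc k)
    define s where "s = (\<Sum>k\<in>{1..k}. (c k)\<^sup>2)"
    define a where "a = (c (Suc k))\<^sup>2"
    have IH: "code_expect k (F k) = m" "code_expect k (\<lambda>v. (F k v - m)\<^sup>2) \<le> s" "code_expect k (\<lambda>v. (F k v - m) ^ 4) \<le> 4 * s\<^sup>2"
      using Suc by (auto simp: s_def)
    have sS: "(\<Sum>k\<in>{1..Suc k}. (c k)\<^sup>2) = s + a" by (simp add: s_def a_def)
    have kn: "k < n" using Suc by simp
    have 1: "code_expect (Suc k) (F (Suc k)) = m"
      unfolding code_expect_Suc IH(1)[symmetric] by (intro code_expect_cong mart[OF kn])
    have "code_expect (Suc k) (\<lambda>v. (F (Suc k) v - m)\<^sup>2) \<le> code_expect k (\<lambda>v. (F k v - m)\<^sup>2 + a)"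
      unfolding code_expect_Suc a_def by (intro code_expect_mono step kn)
    then have 2: "code_expect (Suc k) (\<lambda>v. (F (Suc k) v - m)\<^sup>2) \<le> s + a"
      using IH by (simp add: code_expect_add code_expect_const)
    have "code_expect (Suc k) (\<lambda>v. (F (Suc k) v - m) ^ 4) \<le>
        code_expect k (\<lambda>v. (F k v - m) ^ 4 + 8 * a * (F k v - m)\<^sup>2 + 4 * a\<^sup>2)"
      unfolding code_expect_Suc a_def by (intro code_expect_mono step kn)
    also have "\<dots> = code_expect k (\<lambda>v. (F k v - m) ^ 4) + 8 * a * code_expect k (\<lambda>v. (F k v - m)\<^sup>2) + 4 * a\<^sup>2"
      by (simp add: code_expect_add code_expect_const code_expect_cmult)
    also have "\<dots> \<le> 4 * s\<^sup>2 + 8 * a * s + 4 * a\<^sup>2"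
      using IH by (intro add_mono mult_left_mono) (auto simp: a_def)
    also have "\<dots> = 4 * (s + a)\<^sup>2" by (simp add: power2_sum)
    finally show ?case using 1 2 unfolding sS by simp
  qed
  from this[of n] show "code_expect n (F n) = m" "code_expect n (\<lambda>v. (F n v - m) ^ 4) \<le> 4 * (\<Sum>k\<in>{1..n}. (c k)\<^sup>2)\<^sup>2"
    by auto
qed

end

section \<open>Signs of pairs in terms of codes\<close>

context subunit
begin

text \<open>If \<open>v\<close> is the code of \<open>\<rho>\<close>, then \<open>code_rank v i d\<close> is the rank of \<open>\<rho> i\<close>, counted from the largest, among
  \<open>\<rho> 1, \<dots>, \<rho> (i + d)\<close>.\<close>

primrec code_rank :: "(nat \<Rightarrow> nat) \<Rightarrow> nat \<Rightarrow> nat \<Rightarrow> nat" where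
  "code_rank v i 0 = Suc (v i)"
| "code_rank v i (Suc d) = code_rank v i d + (if v (i + Suc d) < code_rank v i d then 1 else 0)"

text \<open>If \<open>v\<close> is the code of \<rho>, then \<open>v j\<close> counts the values
  before position \<open>j\<close> that exceed \<rho> j. This is below the rank of \<rho> i exactly
  when \<rho> i < \<rho> j. The argument \<open>j - 1 - i\<close> selects the rank just before
  \<open>j\<close> is inserted.\<close>

definition code_sign :: "(nat \<Rightarrow> nat) \<Rightarrow> nat \<Rightarrow> nat \<Rightarrow> real" where
  "code_sign v i j = (if v j < code_rank v i (j - 1 - i) then 1 else -1)"

lemma code_rank_upd: "i + d < k \<Longrightarrow> code_rank (v(k := u)) i d = code_rank v i d"
  by (induction d) auto

lemma code_sign_upd: "i < j \<Longrightarrow> j < k \<Longrightarrow> code_sign (v(k := u)) i j = code_sign v i j"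
  by (simp add: code_sign_def code_rank_upd)

definition geom_cdf :: "nat \<Rightarrow> nat \<Rightarrow> real" where
  "geom_cdf k r = (\<Sum>u | u < k \<and> u < r. geom_wt k u)"

lemma geom_cdf_bounds:
  assumes "k > 0" shows "0 \<le> geom_cdf k r" "geom_cdf k r \<le> 1"
proof -
  show "0 \<le> geom_cdf k r" unfolding geom_cdf_def by (intro sum_nonneg geom_wt_nonneg)
  have "geom_cdf k r \<le> (\<Sum>u<k. geom_wt k u)"
    unfolding geom_cdf_def by (intro sum_mono2) (auto simp: geom_wt_nonneg)
  then show "geom_cdf k r \<le> 1" using sum_geom_wt[OF assms] by simp
qed

lemma geom_cdf_Suc: "geom_cdf k r \<le> geom_cdf k (Suc r)" "geom_cdf k (Suc r) \<le> geom_cdf k r + geom_wt k 0"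
proof -
  show "geom_cdf k r \<le> geom_cdf k (Suc r)"
    unfolding geom_cdf_def by (intro sum_mono2) (auto simp: geom_wt_nonneg)
  have "geom_cdf k (Suc r) \<le> (\<Sum>u\<in>insert r {u. u < k \<and> u < r}. geom_wt k u)"
    unfolding geom_cdf_def by (intro sum_mono2) (auto simp: geom_wt_nonneg)
  also have "\<dots> = geom_cdf k r + geom_wt k r" unfolding geom_cdf_def by simp
  finally show "geom_cdf k (Suc r) \<le> geom_cdf k r + geom_wt k 0" using geom_wt_le[of k r] by linarith
qed

lemma sum_geom_wt_if:
  assumes "k > 0"
  shows "(\<Sum>u<k. geom_wt k u * (if u < r then a else b)) = geom_cdf k r * a + (1 - geom_cdf k r) * b"
proof -
  have eq: "geom_wt k u * (if u < r then a else b) = (if u < r then geom_wt k u else 0) * (a - b) + geom_wt k u * b" for u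
    by (simp add: algebra_simps)
  have "(\<Sum>u<k. if u < r then geom_wt k u else 0) = geom_cdf k r"
    unfolding geom_cdf_def by (subst sum.inter_filter[symmetric]) (auto intro: sum.cong)
  then show ?thesis
    unfolding eq sum.distrib sum_distrib_right[symmetric] using sum_geom_wt[OF assms]
    by (simp add: algebra_simps)
qed

text \<open>\<open>cond_sign j k r\<close> is the conditional mean of the sign of a pair \<open>(i, j)\<close> given that
  \<open>i\<close> has rank \<open>r\<close> from the right after the insertion of \<open>k < j\<close>.\<close>

function cond_sign :: "nat \<Rightarrow> nat \<Rightarrow> nat \<Rightarrow> real" where
  "cond_sign j k r = (if j \<le> Suc k then \<Sum>u<Suc k. geom_wt (Suc k) u * (if u < r then 1 else -1)
     else \<Sum>u<Suc k. geom_wt (Suc k) u * (if u < r then cond_sign j (Suc k) (Suc r) else cond_sign j (Suc k) r))"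
  by auto
termination by (relation "inv_image less_than (\<lambda>(j, k, r). j - k)") auto

declare cond_sign.simps [simp del]

lemma cond_sign_rec:
  "j \<le> Suc k \<Longrightarrow> cond_sign j k r = geom_cdf (Suc k) r - (1 - geom_cdf (Suc k) r)"
  "j > Suc k \<Longrightarrow> cond_sign j k r = geom_cdf (Suc k) r * cond_sign j (Suc k) (Suc r) +
      (1 - geom_cdf (Suc k) r) * cond_sign j (Suc k) r"
  by (simp_all add: cond_sign.simps[of j k r] sum_geom_wt_if del: sum.lessThan_Suc)

lemma abs_cond_sign_le: "\<bar>cond_sign j k r\<bar> \<le> 1"
proof (induction "j - Suc k" arbitrary: k r)
  case 0
  then show ?case using geom_cdf_bounds[of "Suc k" r] by (simp add: cond_sign_rec)
next
  case (Suc d)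
  let ?c = "geom_cdf (Suc k) r" let ?x = "cond_sign j (Suc k) (Suc r)" let ?y = "cond_sign j (Suc k) r"
  note b = geom_cdf_bounds[of "Suc k" r]
  have j: "j > Suc k" using Suc by auto
  have IH: "\<bar>?x\<bar> \<le> 1" "\<bar>?y\<bar> \<le> 1" using Suc(1)[of "Suc k"] Suc(2) by auto
  have "\<bar>?c * ?x + (1 - ?c) * ?y\<bar> \<le> ?c * \<bar>?x\<bar> + (1 - ?c) * \<bar>?y\<bar>"
    using b by (intro order_trans[OF abs_triangle_ineq]) (simp add: abs_mult)
  also have "\<dots> \<le> ?c * 1 + (1 - ?c) * 1"
    using b IH by (intro add_mono mult_left_mono) auto
  finally show ?case using j by (simp add: cond_sign_rec)
qed

text \<open>Two adjacent ranks stay adjacent under an insertion unless it falls exactly between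
  them, which makes the gap 2. Hence one insertion multiplies the Lipschitz constant by at most
  \<open>1 + geom_wt (Suc k) 0\<close>, and \<open>geom_wt_0_Suc\<close> absorbs this into the
  weight at the price of 1 + \<delta>. The initial factor 2 is the range from -1 to 1.\<close>

lemma cond_sign_Lipschitz:
  assumes "k < j"
  shows "\<bar>cond_sign j k (Suc r) - cond_sign j k r\<bar> \<le> 2 * (1 + (1 - \<phi>)) ^ (j - Suc k) * geom_wt (Suc k) 0"
  using assms
proof (induction "j - Suc k" arbitrary: k r)
  case 0
  then show ?case using geom_cdf_Suc[of "Suc k" r] by (simp add: cond_sign_rec)
next
  case (Suc d)
  let ?c = "geom_cdf (Suc k) r" let ?c' = "geom_cdf (Suc k) (Suc r)"
  let ?x = "cond_sign j (Suc k)"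
  define L where "L = 2 * (1 + (1 - \<phi>)) ^ (j - Suc (Suc k)) * geom_wt (Suc (Suc k)) 0"
  have j: "j > Suc k" using Suc by auto
  have d: "j - Suc (Suc k) = d" using Suc(2) by simp
  have IH: "\<bar>?x (Suc r) - ?x r\<bar> \<le> L" for r
    unfolding L_def using Suc(1)[of "Suc k" r] Suc(2) j by auto
  note b = geom_cdf_bounds[of "Suc k"]
  have "cond_sign j k (Suc r) - cond_sign j k r = ?c' * (?x (Suc (Suc r)) - ?x (Suc r)) + (1 - ?c) * (?x (Suc r) - ?x r)"
    using j by (simp add: cond_sign_rec algebra_simps)
  also have "\<bar>\<dots>\<bar> \<le> ?c' * \<bar>?x (Suc (Suc r)) - ?x (Suc r)\<bar> + (1 - ?c) * \<bar>?x (Suc r) - ?x r\<bar>"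
    using b by (intro order_trans[OF abs_triangle_ineq]) (simp add: abs_mult)
  also have "\<dots> \<le> ?c' * L + (1 - ?c) * L"
    using b IH by (intro add_mono mult_left_mono) auto
  also have "\<dots> = (1 + (?c' - ?c)) * L" by (simp add: algebra_simps)
  also have "\<dots> \<le> (1 + geom_wt (Suc k) 0) * L"
    using geom_cdf_Suc[of "Suc k" r] phi_less_1 unfolding L_def
    by (intro mult_right_mono mult_nonneg_nonneg) (auto simp: geom_wt_nonneg)
  also have "\<dots> = 2 * (1 + (1 - \<phi>)) ^ d * ((1 + geom_wt (Suc k) 0) * geom_wt (Suc (Suc k)) 0)"
    unfolding L_def using d by simp
  also have "\<dots> \<le> 2 * (1 + (1 - \<phi>)) ^ d * ((1 + (1 - \<phi>)) * geom_wt (Suc k) 0)"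
    using phi_less_1 by (intro mult_left_mono geom_wt_0_Suc) auto
  also have "\<dots> = 2 * (1 + (1 - \<phi>)) ^ (j - Suc k) * geom_wt (Suc k) 0"
    by (simp flip: Suc(2))
  finally show ?case .
qed

text \<open>The conditional mean of the sign of \<open>(i, j)\<close> given the first \<open>k\<close> code entries.\<close>

definition proj_sign :: "nat \<Rightarrow> nat \<Rightarrow> nat \<Rightarrow> (nat \<Rightarrow> nat) \<Rightarrow> real" where
  "proj_sign i j k v = (if j \<le> k then code_sign v i j
     else if i \<le> k then cond_sign j k (code_rank v i (k - i))
     else \<Sum>u<i. geom_wt i u * cond_sign j i (Suc u))"

lemma proj_sign_martingale:
  assumes "i < j"
  shows "(\<Sum>u<Suc k. geom_wt (Suc k) u * proj_sign i j (Suc k) (v(Suc k := u))) = proj_sign i j k v"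
proof -
  have one: "(\<Sum>u<Suc k. geom_wt (Suc k) u * c) = c" for c
    using sum_geom_wt[of "Suc k"] by (simp del: sum.lessThan_Suc flip: sum_distrib_right)
  \<comment> \<open>The new entry comes after \<open>j\<close>, is \<open>j\<close>, lies between
    \<open>i\<close> and \<open>j\<close>, is \<open>i\<close>, or comes before
    \<open>i\<close>.\<close>
  consider "j \<le> k" | "j = Suc k" | "i \<le> k" "j > Suc k" | "i = Suc k" | "i > Suc k"
    using assms by linarith
  then show ?thesis
  proof cases
    case 1
    then show ?thesis using assms one by (simp add: proj_sign_def code_sign_upd del: sum.lessThan_Suc)
  next
    case 2
    moreover have "proj_sign i j k v = cond_sign j k (code_rank v i (k - i))"
      using 2 assms by (simp add: proj_sign_def)
    ultimately show ?thesis using assms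
      by (simp add: cond_sign.simps[of "Suc k" k] proj_sign_def code_sign_def code_rank_upd del: sum.lessThan_Suc)
  next
    case 3
    have "code_rank (v(Suc k := u)) i (Suc k - i) = code_rank v i (k - i) + (if u < code_rank v i (k - i) then 1 else 0)" for u
      using 3 by (simp add: Suc_diff_le code_rank_upd)
    then have "proj_sign i j (Suc k) (v(Suc k := u)) =
        (if u < code_rank v i (k - i) then cond_sign j (Suc k) (Suc (code_rank v i (k - i))) else cond_sign j (Suc k) (code_rank v i (k - i)))" for u
      using 3 by (simp add: proj_sign_def)
    moreover have "proj_sign i j k v = cond_sign j k (code_rank v i (k - i))" using 3 by (simp add: proj_sign_def)
    ultimately show ?thesis
      using 3 by (simp only: cond_sign.simps[of j k]) (simp del: sum.lessThan_Suc)
  next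
    case 4
    then show ?thesis using assms by (simp add: proj_sign_def del: sum.lessThan_Suc)
  next
    case 5
    then show ?thesis using assms one by (simp add: proj_sign_def del: sum.lessThan_Suc)
  qed
qed

lemma abs_proj_sign_le: "i > 0 \<Longrightarrow> \<bar>proj_sign i j k v\<bar> \<le> 1"
proof -
  assume "i > 0"
  have "\<bar>\<Sum>u<i. geom_wt i u * cond_sign j i (Suc u)\<bar> \<le> (\<Sum>u<i. geom_wt i u * 1)"
    by (intro order_trans[OF sum_abs] sum_mono) (simp only: abs_mult abs_of_nonneg[OF geom_wt_nonneg], intro mult_left_mono abs_cond_sign_le geom_wt_nonneg)
  also have "\<dots> = 1" using sum_geom_wt[OF \<open>i > 0\<close>] by simp
  finally show ?thesis by (auto simp: proj_sign_def code_sign_def abs_cond_sign_le)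
qed

text \<open>Entries outside the interval from \<open>i\<close> to \<open>j\<close> leave the
  conditional mean unchanged, and at \<open>i\<close> and \<open>j\<close> the trivial bound 2 is
  used. An entry strictly between moves the rank of \<open>i\<close> by at most one, so the
  Lipschitz bound applies.\<close>

lemma proj_sign_increment:
  assumes "0 < i" "i < j" "(1 - \<phi>) * real (j - i) \<le> 1"
  shows "\<bar>proj_sign i j (Suc k) (v(Suc k := u)) - proj_sign i j k v\<bar> \<le>
     (if i = Suc k \<or> j = Suc k then 2
      else if i < Suc k \<and> Suc k < j then 6 * geom_wt (Suc (Suc k)) 0 else 0)"
proof -
  consider "i = Suc k \<or> j = Suc k" | "i < Suc k" "Suc k < j" | "i > Suc k \<or> j < Suc k"
    by linarith
  then show ?thesis
  proof cases
    case 1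
    then show ?thesis using abs_proj_sign_le[of i j "Suc k" "v(Suc k := u)"] abs_proj_sign_le[of i j k v] assms
      by auto
  next
    case 2
    let ?r = "code_rank v i (k - i)"
    let ?L = "6 * geom_wt (Suc (Suc k)) 0"
    \<comment> \<open>The losses 1 + \<delta> multiply to at most e \<le> 3, as \<delta> (j - i)
      \<le> 1; this gives 6 = 2 * 3.\<close>
    have "(1 + (1 - \<phi>)) ^ (j - Suc (Suc k)) \<le> exp (1 - \<phi>) ^ (j - Suc (Suc k))"
      using phi_less_1 exp_ge_add_one_self[of "1 - \<phi>"] by (intro power_mono) auto
    also have "\<dots> = exp (real (j - Suc (Suc k)) * (1 - \<phi>))" by (simp add: exp_of_nat_mult)
    also have "\<dots> \<le> exp (real (j - i) * (1 - \<phi>))"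
      using 2 phi_less_1 by (simp add: mult_right_mono)
    also have "\<dots> \<le> exp 1" using assms by (simp add: mult.commute)
    also have "\<dots> \<le> 3" by (rule exp_le)
    finally have "2 * (1 + (1 - \<phi>)) ^ (j - Suc (Suc k)) * geom_wt (Suc (Suc k)) 0 \<le> ?L"
      by (intro mult_right_mono) (auto simp: geom_wt_nonneg)
    then have Lip: "\<bar>cond_sign j (Suc k) (Suc r) - cond_sign j (Suc k) r\<bar> \<le> ?L" for r
      using cond_sign_Lipschitz[OF 2(2), of r] by linarith
    \<comment> \<open>The new conditional mean is \<open>x\<close> or \<open>y\<close> and the old
      one is a convex combination of both, so they differ by at most the distance of
      \<open>x\<close> and \<open>y\<close>.\<close>
    define x y c where "x = cond_sign j (Suc k) (Suc ?r)" "y = cond_sign j (Suc k) ?r" "c = geom_cdf (Suc k) ?r"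
    have c: "0 \<le> c" "c \<le> 1" using geom_cdf_bounds[of "Suc k" ?r] by (auto simp: x_y_c_def)
    have "proj_sign i j k v = c * x + (1 - c) * y"
      using 2 assms by (simp add: proj_sign_def cond_sign_rec x_y_c_def)
    moreover have "proj_sign i j (Suc k) (v(Suc k := u)) = (if u < ?r then x else y)"
      using 2 assms by (simp add: proj_sign_def code_rank_upd Suc_diff_le x_y_c_def)
    moreover have "x - (c * x + (1 - c) * y) = (1 - c) * (x - y)" "y - (c * x + (1 - c) * y) = - (c * (x - y))"
      by (simp_all add: algebra_simps)
    ultimately have "\<bar>proj_sign i j (Suc k) (v(Suc k := u)) - proj_sign i j k v\<bar> \<le> 1 * \<bar>x - y\<bar>"
      using c by (auto simp: abs_mult mult_left_le_one_le)
    then show ?thesis using Lip[of ?r] 2 by (auto simp: x_y_c_def)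
  next
    case 3
    then show ?thesis using assms by (auto simp: proj_sign_def code_sign_upd)
  qed
qed

end

section \<open>Permutations and their Lehmer codes\<close>

definition inversions :: "nat \<Rightarrow> (nat \<Rightarrow> nat) \<Rightarrow> nat" where
  "inversions n \<rho> = card {(a, b). a \<in> {1..n} \<and> b \<in> {1..n} \<and> a < b \<and> \<rho> b < \<rho> a}"

definition code :: "nat \<Rightarrow> (nat \<Rightarrow> nat) \<Rightarrow> nat \<Rightarrow> nat" where
  "code n \<rho> = (\<lambda>k\<in>{1..n}. card {a \<in> {1..<k}. \<rho> k < \<rho> a})"

text \<open>Inversions are grouped by their right end. As a consequence
  \<open>\<phi> ^ inversions n \<rho>\<close> is a product over the code entries.\<close>

lemma inversions_eq_sum_code: "inversions n \<rho> = (\<Sum>k\<in>{1..n}. code n \<rho> k)"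
proof -
  have "{(a, b). a \<in> {1..n} \<and> b \<in> {1..n} \<and> a < b \<and> \<rho> b < \<rho> a}
      = (\<lambda>(k, a). (a, k)) ` (SIGMA k:{1..n}. {a \<in> {1..<k}. \<rho> k < \<rho> a})"
    by (auto simp: image_iff)
  then have "inversions n \<rho> = card (SIGMA k:{1..n}. {a \<in> {1..<k}. \<rho> k < \<rho> a})"
    unfolding inversions_def by (simp add: card_image inj_on_def)
  also have "\<dots> = (\<Sum>k\<in>{1..n}. card {a \<in> {1..<k}. \<rho> k < \<rho> a})"
    by (rule card_SigmaI) auto
  also have "\<dots> = (\<Sum>k\<in>{1..n}. code n \<rho> k)"
    by (intro sum.cong) (auto simp: code_def)
  finally show ?thesis .
qed

lemma permutes_less_or:
  "\<rho> permutes S \<Longrightarrow> a \<noteq> b \<Longrightarrow> (\<rho> a < \<rho> b \<or> \<rho> b < (\<rho> a :: nat))"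
  using injD[OF permutes_inj, of \<rho> S a b] by linarith

context subunit
begin

lemma code_in_codes: "code n \<rho> \<in> codes n"
proof -
  have "card {a \<in> {1..<k}. \<rho> k < \<rho> a} < k" if "k \<ge> 1" for k
  proof -
    have "card {a \<in> {1..<k}. \<rho> k < \<rho> a} \<le> card {1..<k}" by (intro card_mono) auto
    also have "\<dots> < k" using that by simp
    finally show ?thesis .
  qed
  then show ?thesis by (auto simp: codes_def code_def)
qed

text \<open>Both numbers count the earlier values above a threshold, so the two sets are nested; the
  inclusion is strict, witnessed by \<open>i\<close> itself, exactly if \<rho> i < \<rho> k.\<close>

lemma code_less_iff:
  assumes "\<rho> permutes {1..n}" "1 \<le> i" "i < k" "k \<le> n"
  shows "code n \<rho> k < card {a \<in> {1..<k}. \<rho> i \<le> \<rho> a} \<longleftrightarrow> \<rho> i < \<rho> k"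
proof (cases "\<rho> i < \<rho> k")
  case True
  have "{a \<in> {1..<k}. \<rho> k < \<rho> a} \<subset> {a \<in> {1..<k}. \<rho> i \<le> \<rho> a}"
    using True assms by (auto simp: psubset_eq set_eq_iff intro!: exI[of _ i])
  then show ?thesis using True assms by (auto simp: code_def intro: psubset_card_mono)
next
  case False
  then have "\<rho> k < \<rho> i" using permutes_less_or[OF assms(1), of i k] assms by auto
  then have "{a \<in> {1..<k}. \<rho> i \<le> \<rho> a} \<subseteq> {a \<in> {1..<k}. \<rho> k < \<rho> a}" by auto
  then have "card {a \<in> {1..<k}. \<rho> i \<le> \<rho> a} \<le> card {a \<in> {1..<k}. \<rho> k < \<rho> a}"
    by (intro card_mono) simp_all
  also have "\<dots> = code n \<rho> k" using assms by (simp add: code_def)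
  finally have "card {a \<in> {1..<k}. \<rho> i \<le> \<rho> a} \<le> code n \<rho> k" .
  then show ?thesis using False by auto
qed

lemma code_rank_code:
  assumes "\<rho> permutes {1..n}" "1 \<le> i" "i + d \<le> n"
  shows "code_rank (code n \<rho>) i d = card {a \<in> {1..<Suc (i + d)}. \<rho> i \<le> \<rho> a}"
  using assms(3)
proof (induction d)
  case 0
  have "{a \<in> {1..<Suc i}. \<rho> i \<le> \<rho> a} = insert i {a \<in> {1..<i}. \<rho> i < \<rho> a}"
    using assms(2) injD[OF permutes_inj[OF assms(1)], of i] by (auto simp: less_Suc_eq le_less)
  then show ?case using assms 0 by (simp add: code_def)
next
  case (Suc d)
  let ?k = "i + Suc d"
  have IH: "code_rank (code n \<rho>) i d = card {a \<in> {1..<?k}. \<rho> i \<le> \<rho> a}" using Suc by simp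
  have *: "code n \<rho> ?k < code_rank (code n \<rho>) i d \<longleftrightarrow> \<rho> i < \<rho> ?k"
    unfolding IH using code_less_iff[OF assms(1,2), of ?k] Suc by simp
  show ?case
  proof (cases "\<rho> i < \<rho> ?k")
    case True
    then have "{a \<in> {1..<Suc ?k}. \<rho> i \<le> \<rho> a} = insert ?k {a \<in> {1..<?k}. \<rho> i \<le> \<rho> a}" by auto
    then have "card {a \<in> {1..<Suc ?k}. \<rho> i \<le> \<rho> a} = Suc (card {a \<in> {1..<?k}. \<rho> i \<le> \<rho> a})" by simp
    then show ?thesis using True * IH by simp
  next
    case False
    then have "\<rho> ?k < \<rho> i" using permutes_less_or[OF assms(1), of i ?k] by auto
    then have "{a \<in> {1..<Suc ?k}. \<rho> i \<le> \<rho> a} = {a \<in> {1..<?k}. \<rho> i \<le> \<rho> a}"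
      by (auto simp: less_Suc_eq)
    then show ?thesis using False * IH by simp
  qed
qed

lemma code_sign_code:
  assumes "\<rho> permutes {1..n}" "1 \<le> i" "i < j" "j \<le> n"
  shows "code_sign (code n \<rho>) i j = (if \<rho> i < \<rho> j then 1 else -1)"
proof -
  have "Suc (i + (j - 1 - i)) = j" "i + (j - 1 - i) \<le> n" using assms by auto
  then show ?thesis
    using code_rank_code[OF assms(1,2), of "j - 1 - i"] code_less_iff[OF assms] by (simp add: code_sign_def)
qed

text \<open>Injectivity: the final rank of a position determines its value. Surjectivity: both sides
  have n! elements.\<close>

lemma bij_betw_code: "bij_betw (code n) {\<rho>. \<rho> permutes {1..n}} (codes n)"
proof -
  have inj: "inj_on (code n) {\<rho>. \<rho> permutes {1..n}}"
  proof (rule inj_onI, clarsimp)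
    fix \<rho> \<rho>' assume p: "\<rho> permutes {Suc 0..n}" "\<rho>' permutes {Suc 0..n}" and eq: "code n \<rho> = code n \<rho>'"
    \<comment> \<open>The values at least \<rho> i are those from \<rho> i to \<open>n\<close>, so
      the rank from the largest is \<open>Suc n - \<rho> i\<close>.\<close>
    have r: "code_rank (code n \<rho>) i (n - i) = Suc n - \<rho> i" if "\<rho> permutes {1..n}" "i \<in> {1..n}" for \<rho> i
    proof -
      have "\<rho> ` {a \<in> {1..<Suc n}. \<rho> i \<le> \<rho> a} = {\<rho> i..n}"
      proof safe
        fix a assume "a \<in> {1..<Suc n}"
        then show "\<rho> a \<in> {\<rho> i..n}" if "\<rho> i \<le> \<rho> a"
          using permutes_in_image[OF \<open>\<rho> permutes {1..n}\<close>, of a] that by auto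
      next
        fix x assume x: "x \<in> {\<rho> i..n}"
        then have "x \<in> {1..n}" using permutes_in_image[OF \<open>\<rho> permutes {1..n}\<close>, of i] that by auto
        then obtain a where "a \<in> {1..n}" "x = \<rho> a"
          using permutes_image[OF \<open>\<rho> permutes {1..n}\<close>] by (metis imageE)
        then show "x \<in> \<rho> ` {a \<in> {1..<Suc n}. \<rho> i \<le> \<rho> a}" using x by auto
      qed
      moreover have "inj_on \<rho> A" for A using permutes_inj[OF that(1)] by (meson inj_on_subset subset_UNIV)
      ultimately have "card {a \<in> {1..<Suc n}. \<rho> i \<le> \<rho> a} = Suc n - \<rho> i"
        by (metis card_image card_atLeastAtMost)
      then show ?thesis using code_rank_code[OF that(1), of i "n - i"] that by simp
    qed
    have "\<rho> i = \<rho>' i" for i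
    proof (cases "i \<in> {1..n}")
      case True
      then have "Suc n - \<rho> i = Suc n - \<rho>' i"
        using r[of \<rho> i] r[of \<rho>' i] p eq by simp
      moreover have "\<rho> i \<le> n" "\<rho>' i \<le> n"
        using True p permutes_in_image[of \<rho> "{1..n}" i] permutes_in_image[of \<rho>' "{1..n}" i] by auto
      ultimately show ?thesis by linarith
    next
      case False
      then show ?thesis using p by (simp add: permutes_not_in)
    qed
    then show "\<rho> = \<rho>'" by auto
  qed
  have fin: "finite (codes n)" unfolding codes_def by (intro finite_PiE) auto
  have "card (codes n) = fact n"
    unfolding codes_def by (subst card_PiE) (simp_all add: fact_prod)
  moreover have "card (code n ` {\<rho>. \<rho> permutes {1..n}}) = fact n"
    by (subst card_image[OF inj]) (simp add: card_permutations)
  ultimately have "code n ` {\<rho>. \<rho> permutes {1..n}} = codes n"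
    using code_in_codes by (intro card_subset_eq[OF fin]) auto
  with inj show ?thesis by (simp add: bij_betw_def)
qed

definition inv_Z :: "nat \<Rightarrow> real" where
  "inv_Z n = (\<Sum>\<rho> | \<rho> permutes {1..n}. \<phi> ^ inversions n \<rho>)"

text \<open>Under the inversion weight the code entries become independent truncated geometric
  variables, because the code is a bijection and the weight factors over it.\<close>

lemma sum_permutes_eq_code_expect:
  "(\<Sum>\<rho> | \<rho> permutes {1..n}. \<phi> ^ inversions n \<rho> * F (code n \<rho>)) = inv_Z n * code_expect n F"
proof -
  define P where "P = (\<Prod>k\<in>{1..n}. \<Sum>u<k. \<phi> ^ u)"
  have Pne: "P \<noteq> 0" unfolding P_def
    using less_imp_neq[OF geom_sum_pos] by (subst prod_zero_iff) (auto simp: Suc_le_eq)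
  have *: "(\<Sum>\<rho> | \<rho> permutes {1..n}. \<phi> ^ inversions n \<rho> * F (code n \<rho>)) = P * code_expect n F" for F
  proof -
    have "(\<Sum>\<rho> | \<rho> permutes {1..n}. \<phi> ^ inversions n \<rho> * F (code n \<rho>))
       = (\<Sum>\<rho> | \<rho> permutes {1..n}. \<phi> ^ (\<Sum>k\<in>{1..n}. code n \<rho> k) * F (code n \<rho>))"
      by (simp only: inversions_eq_sum_code)
    also have "\<dots> = (\<Sum>v\<in>codes n. \<phi> ^ (\<Sum>k\<in>{1..n}. v k) * F v)"
      by (rule sum.reindex_bij_betw[OF bij_betw_code])
    also have "\<dots> = (\<Sum>v\<in>codes n. P * ((\<Prod>k\<in>{1..n}. geom_wt k (v k)) * F v))"
      using Pne by (intro sum.cong refl) (simp add: geom_wt_def prod_dividef power_sum P_def)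
    finally show ?thesis by (simp add: code_expect_def sum_distrib_left)
  qed
  \<comment> \<open>The constant function 1 identifies the normalising constant.\<close>
  have "inv_Z n = P" using *[of "\<lambda>_. 1"] by (simp add: inv_Z_def code_expect_const)
  with * show ?thesis by simp
qed

end

text \<open>The swap makes (i, j) an inversion. An index between \<open>i\<close> and
  \<open>j\<close> whose value also lies between gains an inversion with each of them; for every
  other index the contributions cancel.\<close>

lemma inversions_transpose:
  assumes \<rho>: "\<rho> permutes {1..n}" and ij: "1 \<le> i" "i < j" "j \<le> n" "\<rho> i < \<rho> j"
  shows "inversions n (\<rho> \<circ> Transposition.transpose i j) =
    inversions n \<rho> + 1 + 2 * card {l. i < l \<and> l < j \<and> \<rho> i < \<rho> l \<and> \<rho> l < \<rho> j}"
proof -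
  define S where "S = {1..n}"
  define t where "t = Transposition.transpose i j"
  define B where "B = {l. i < l \<and> l < j \<and> \<rho> i < \<rho> l \<and> \<rho> l < \<rho> j}"
  \<comment> \<open>After reindexing along \<open>t\<close>, this is the change that the swap causes
    at the pair of values \<rho> a, \<rho> b. It vanishes unless the pair meets {i, j}, and it may
    be negative, hence the integers.\<close>
  define f :: "nat \<Rightarrow> nat \<Rightarrow> int" where
    "f a b = (of_bool (t a < t b) - of_bool (a < b)) * of_bool (\<rho> b < \<rho> a)" for a b
  have fin: "finite S" by (simp add: S_def)
  have tS: "t permutes S" using ij by (auto simp: t_def S_def intro: permutes_swap_id)
  have tt: "t (t a) = a" for a by (simp add: t_def)
  have inv_sum: "int (inversions n \<rho>') = (\<Sum>a\<in>S. \<Sum>b\<in>S. of_bool (a < b) * of_bool (\<rho>' b < \<rho>' a))" for \<rho>'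
  proof -
    have "{(a, b). a \<in> {1..n} \<and> b \<in> {1..n} \<and> a < b \<and> \<rho>' b < \<rho>' a} =
      {x \<in> S \<times> S. fst x < snd x \<and> \<rho>' (snd x) < \<rho>' (fst x)}" by (auto simp: S_def)
    then have "int (inversions n \<rho>') = (\<Sum>x\<in>S\<times>S. of_bool (fst x < snd x \<and> \<rho>' (snd x) < \<rho>' (fst x)))"
      unfolding inversions_def using fin by (simp add: Int_def flip: of_bool_def)
    then show ?thesis by (simp add: sum.cartesian_product case_prod_unfold of_bool_conj)
  qed
  have "int (inversions n (\<rho> \<circ> t)) = (\<Sum>a\<in>S. \<Sum>b\<in>S. of_bool (t a < t b) * of_bool (\<rho> b < \<rho> a))"
    unfolding inv_sum
    by (subst sum.permute[OF tS], intro sum.cong refl, subst sum.permute[OF tS]) (simp add: o_def tt)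
  then have diff: "int (inversions n (\<rho> \<circ> t)) - int (inversions n \<rho>) = (\<Sum>a\<in>S. \<Sum>b\<in>S. f a b)"
    unfolding inv_sum by (simp add: f_def left_diff_distrib sum_subtractf)
  define S0 where "S0 = S - {i, j}"
  have S0: "S = insert i (insert j S0)" "finite S0" "i \<notin> S0" "j \<notin> S0" "i \<noteq> j" using ij fin by (auto simp: S0_def S_def)
  have f0: "f a b = 0" if "a \<in> S0" "b \<in> S0" for a b
    using that by (auto simp: f_def t_def S0_def transpose_def)
  have tij: "t i = j" "t j = i" by (auto simp: t_def)
  have "(\<Sum>a\<in>S. \<Sum>b\<in>S. f a b) = f i i + f i j + f j i + f j j + (\<Sum>l\<in>S0. f i l + f j l + f l i + f l j)"
    using S0 f0 by (simp add: sum.distrib)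
  also have "f i i + f i j + f j i + f j j = 1" using ij by (simp add: f_def tij)
  also have "(\<Sum>l\<in>S0. f i l + f j l + f l i + f l j) = (\<Sum>l\<in>S0. 2 * of_bool (l \<in> B))"
  proof (intro sum.cong refl)
    fix l assume l: "l \<in> S0"
    then have "t l = l" "l \<noteq> i" "l \<noteq> j" by (auto simp: t_def S0_def)
    moreover have "\<rho> l \<noteq> \<rho> i" "\<rho> l \<noteq> \<rho> j" using permutes_inj[OF \<rho>] calculation by (auto dest: injD)
    ultimately show "f i l + f j l + f l i + f l j = 2 * of_bool (l \<in> B)"
      using ij by (auto simp: f_def tij B_def not_less)
  qed
  also have "\<dots> = 2 * int (card B)"
  proof -
    have "S0 \<inter> B = B" using ij by (auto simp: B_def S0_def S_def)
    then show ?thesis using S0 by (simp add: sum_distrib_left[symmetric])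
  qed
  finally show ?thesis using diff unfolding t_def B_def by linarith
qed

section \<open>Expected signs\<close>

context subunit
begin

definition inv_wt :: "nat \<Rightarrow> ((nat \<Rightarrow> nat) \<Rightarrow> bool) \<Rightarrow> real" where
  "inv_wt n C = (\<Sum>\<rho> | \<rho> permutes {1..n} \<and> C \<rho>. \<phi> ^ inversions n \<rho>)"

lemma finite_permutes_filter: "finite {\<rho>. \<rho> permutes {1..n::nat} \<and> C \<rho>}"
  by (rule finite_subset[OF _ finite_permutations[of "{1..n}"]]) auto

lemma inv_wt_True: "inv_wt n (\<lambda>_. True) = inv_Z n"
  by (simp add: inv_wt_def inv_Z_def)

lemma inv_wt_split: "inv_wt n C = inv_wt n (\<lambda>\<rho>. C \<rho> \<and> D \<rho>) + inv_wt n (\<lambda>\<rho>. C \<rho> \<and> \<not> D \<rho>)"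
proof -
  have "{\<rho>. \<rho> permutes {1..n} \<and> C \<rho>} =
      {\<rho>. \<rho> permutes {1..n} \<and> C \<rho> \<and> D \<rho>} \<union> {\<rho>. \<rho> permutes {1..n} \<and> C \<rho> \<and> \<not> D \<rho>}"
    by blast
  then show ?thesis
    unfolding inv_wt_def by (simp only:) (rule sum.union_disjoint[OF finite_permutes_filter finite_permutes_filter], blast)
qed

lemma inv_wt_cong: "(\<And>\<rho>. \<rho> permutes {1..n} \<Longrightarrow> C \<rho> = D \<rho>) \<Longrightarrow> inv_wt n C = inv_wt n D"
  unfolding inv_wt_def by (rule sum.cong) auto

lemma sum_transpose:
  fixes i j n :: nat
  assumes "1 \<le> i" "i \<le> n" "1 \<le> j" "j \<le> n"
  shows "(\<Sum>\<rho> | \<rho> permutes {1..n} \<and> C (\<rho> \<circ> Transposition.transpose i j). f \<rho>) =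
    (\<Sum>\<rho> | \<rho> permutes {1..n} \<and> C \<rho>. f (\<rho> \<circ> Transposition.transpose i j))"
proof -
  let ?t = "Transposition.transpose i j"
  have t: "?t permutes {1..n}" using assms by (intro permutes_swap_id) auto
  have tt: "\<rho> \<circ> ?t \<circ> ?t = \<rho>" for \<rho> :: "nat \<Rightarrow> nat" by (simp add: o_assoc[symmetric])
  show ?thesis
    by (rule sum.reindex_bij_witness[of _ "\<lambda>\<rho>. \<rho> \<circ> ?t" "\<lambda>\<rho>. \<rho> \<circ> ?t"])
      (auto simp: tt intro: permutes_compose[OF t] simp del: One_nat_def)
qed

text \<open>Swapping an increasing pair only adds inversions, so an event that forces \<rho> i <
  \<rho> j outweighs its mirror image.\<close>

lemma inv_wt_transpose_le:
  assumes ij: "1 \<le> i" "i < j" "j \<le> n"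
  assumes imp: "\<And>\<rho>. C \<rho> \<Longrightarrow> \<rho> i < \<rho> j"
    and CD: "\<And>\<rho>. C' \<rho> \<longleftrightarrow> C (\<rho> \<circ> Transposition.transpose i j)"
  shows "inv_wt n C' \<le> inv_wt n C"
proof -
  have "inv_wt n C' = (\<Sum>\<rho> | \<rho> permutes {1..n} \<and> C \<rho>. \<phi> ^ inversions n (\<rho> \<circ> Transposition.transpose i j))"
    unfolding inv_wt_def CD using ij by (intro sum_transpose) auto
  also have "\<dots> \<le> inv_wt n C"
    unfolding inv_wt_def
  proof (rule sum_mono, clarify)
    fix \<rho> assume "\<rho> permutes {1..n}" "C \<rho>"
    with ij imp have "inversions n \<rho> \<le> inversions n (\<rho> \<circ> Transposition.transpose i j)"
      by (subst inversions_transpose) auto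
    then show "\<phi> ^ inversions n (\<rho> \<circ> Transposition.transpose i j) \<le> \<phi> ^ inversions n \<rho>"
      using phi_nonneg phi_less_1 by (intro power_decreasing) auto
  qed
  finally show ?thesis .
qed

lemma inv_wt_sorted_pair:
  assumes "1 \<le> i" "i < j" "j \<le> n"
  shows "inv_wt n (\<lambda>\<rho>. \<rho> i < \<rho> j) \<ge> inv_Z n / 2"
proof -
  have "inv_wt n (\<lambda>\<rho>. \<rho> j < \<rho> i) \<le> inv_wt n (\<lambda>\<rho>. \<rho> i < \<rho> j)"
    using assms by (intro inv_wt_transpose_le[of i j]) auto
  moreover have "inv_wt n (\<lambda>\<rho>. True \<and> \<not> \<rho> i < \<rho> j) = inv_wt n (\<lambda>\<rho>. \<rho> j < \<rho> i)"
    using assms by (intro inv_wt_cong) (auto dest: permutes_less_or[where a=i and b=j])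
  ultimately show ?thesis
    using inv_wt_split[of n "\<lambda>_. True" "\<lambda>\<rho>. \<rho> i < \<rho> j"] by (simp add: inv_wt_True)
qed

text \<open>Of the six orders of three values the increasing one is heaviest: three others are
  compared with it by one transposition, the remaining two by a chain of two.\<close>

lemma inv_wt_sorted_triple:
  assumes "1 \<le> i" "i < l" "l < j" "j \<le> n"
  shows "inv_wt n (\<lambda>\<rho>. \<rho> i < \<rho> l \<and> \<rho> l < \<rho> j) \<ge> inv_Z n / 6"
proof -
  define W where "W a b c = inv_wt n (\<lambda>\<rho>. \<rho> a < \<rho> b \<and> \<rho> b < \<rho> c)" for a b c
  have 1: "W l i j \<le> W i l j" unfolding W_def
    using assms by (intro inv_wt_transpose_le[of i l]) (auto simp: transpose_def)
  have 2: "W i j l \<le> W i l j" unfolding W_def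
    using assms by (intro inv_wt_transpose_le[of l j]) (auto simp: transpose_def)
  have 3: "W j l i \<le> W i l j" unfolding W_def
    using assms by (intro inv_wt_transpose_le[of i j]) (auto simp: transpose_def)
  have 4: "W l j i \<le> W l i j" unfolding W_def
    using assms by (intro inv_wt_transpose_le[of i j]) (auto simp: transpose_def)
  have 5: "W j i l \<le> W i j l" unfolding W_def
    using assms by (intro inv_wt_transpose_le[of i j]) (auto simp: transpose_def)
  have split: "inv_wt n C = inv_wt n (\<lambda>\<rho>. C \<rho> \<and> \<rho> a < \<rho> b) + inv_wt n (\<lambda>\<rho>. C \<rho> \<and> \<rho> b < \<rho> a)"
    if "a \<noteq> b" for C a b
  proof -
    have "inv_wt n (\<lambda>\<rho>. C \<rho> \<and> \<not> \<rho> a < \<rho> b) = inv_wt n (\<lambda>\<rho>. C \<rho> \<and> \<rho> b < \<rho> a)"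
      using that by (intro inv_wt_cong) (auto dest: permutes_less_or[where a=a and b=b])
    then show ?thesis using inv_wt_split[of n C "\<lambda>\<rho>. \<rho> a < \<rho> b"] by simp
  qed
  have ilj: "i \<noteq> l" "i \<noteq> j" "l \<noteq> j" using assms by auto
  have "inv_Z n = inv_wt n (\<lambda>\<rho>. \<rho> i < \<rho> l) + inv_wt n (\<lambda>\<rho>. \<rho> l < \<rho> i)"
    using split[OF ilj(1), of "\<lambda>_. True"] by (simp add: inv_wt_True)
  also have "inv_wt n (\<lambda>\<rho>. \<rho> i < \<rho> l) = inv_wt n (\<lambda>\<rho>. \<rho> i < \<rho> l \<and> \<rho> l < \<rho> j) +
      (inv_wt n (\<lambda>\<rho>. (\<rho> i < \<rho> l \<and> \<rho> j < \<rho> l) \<and> \<rho> i < \<rho> j) + inv_wt n (\<lambda>\<rho>. (\<rho> i < \<rho> l \<and> \<rho> j < \<rho> l) \<and> \<rho> j < \<rho> i))"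
    by (subst split[OF ilj(3)], subst (2) split[OF ilj(2)]) simp
  also have "inv_wt n (\<lambda>\<rho>. \<rho> l < \<rho> i) = inv_wt n (\<lambda>\<rho>. \<rho> l < \<rho> i \<and> \<rho> i < \<rho> j) +
      (inv_wt n (\<lambda>\<rho>. (\<rho> l < \<rho> i \<and> \<rho> j < \<rho> i) \<and> \<rho> l < \<rho> j) + inv_wt n (\<lambda>\<rho>. (\<rho> l < \<rho> i \<and> \<rho> j < \<rho> i) \<and> \<rho> j < \<rho> l))"
    by (subst split[OF ilj(2)], subst (2) split[OF ilj(3)]) simp
  finally have Zn: "inv_Z n = inv_wt n (\<lambda>\<rho>. \<rho> i < \<rho> l \<and> \<rho> l < \<rho> j) +
      (inv_wt n (\<lambda>\<rho>. (\<rho> i < \<rho> l \<and> \<rho> j < \<rho> l) \<and> \<rho> i < \<rho> j) + inv_wt n (\<lambda>\<rho>. (\<rho> i < \<rho> l \<and> \<rho> j < \<rho> l) \<and> \<rho> j < \<rho> i)) +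
      (inv_wt n (\<lambda>\<rho>. \<rho> l < \<rho> i \<and> \<rho> i < \<rho> j) +
      (inv_wt n (\<lambda>\<rho>. (\<rho> l < \<rho> i \<and> \<rho> j < \<rho> i) \<and> \<rho> l < \<rho> j) + inv_wt n (\<lambda>\<rho>. (\<rho> l < \<rho> i \<and> \<rho> j < \<rho> i) \<and> \<rho> j < \<rho> l)))" .
  have "inv_wt n (\<lambda>\<rho>. (\<rho> i < \<rho> l \<and> \<rho> j < \<rho> l) \<and> \<rho> i < \<rho> j) = W i j l"
    "inv_wt n (\<lambda>\<rho>. (\<rho> i < \<rho> l \<and> \<rho> j < \<rho> l) \<and> \<rho> j < \<rho> i) = W j i l"
    "inv_wt n (\<lambda>\<rho>. (\<rho> l < \<rho> i \<and> \<rho> j < \<rho> i) \<and> \<rho> l < \<rho> j) = W l j i"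
    "inv_wt n (\<lambda>\<rho>. (\<rho> l < \<rho> i \<and> \<rho> j < \<rho> i) \<and> \<rho> j < \<rho> l) = W j l i"
    unfolding W_def by (rule inv_wt_cong; auto)+
  then have "inv_Z n \<le> 6 * W i l j" using Zn 1 2 3 4 5 unfolding W_def by linarith
  then show ?thesis by (simp add: W_def)
qed

text \<open>Each \<rho> with \<rho> i < \<rho> j is paired with its swap, which has an additional
  factor \<phi>^(1 + 2 |B|) by \<open>inversions_transpose\<close>. The mean sign is therefore at
  least of order \<delta> times the mean of 1 + 2 |B|, and sorted triples make |B| large on
  average.\<close>

lemma expected_sign_ge:
  assumes ij: "1 \<le> i" "i < j" "j \<le> n" and small: "(1 - \<phi>) * real (j - i) \<le> 1"
  shows "(\<Sum>\<rho> | \<rho> permutes {1..n}. \<phi> ^ inversions n \<rho> * (if \<rho> i < \<rho> j then 1 else -1))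
     \<ge> inv_Z n * ((1 - \<phi>) * real (j - i) / 9)"
proof -
  let ?t = "Transposition.transpose i j"
  define B where "B \<rho> = {l. i < l \<and> l < j \<and> \<rho> i < \<rho> l \<and> \<rho> l < \<rho> j}" for \<rho> :: "nat \<Rightarrow> nat"
  define A where "A = {\<rho>. \<rho> permutes {1..n} \<and> \<rho> i < \<rho> j}"
  have A: "finite A" unfolding A_def by (rule finite_permutes_filter)
  have Znn: "inv_Z n \<ge> 0" unfolding inv_Z_def using phi_nonneg by (intro sum_nonneg) auto
  have per: "\<phi> ^ inversions n \<rho> - \<phi> ^ inversions n (\<rho> \<circ> ?t)
      \<ge> \<phi> ^ inversions n \<rho> * ((1 - \<phi>) / 3 * (1 + 2 * real (card (B \<rho>))))" if "\<rho> \<in> A" for \<rho>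
  proof -
    define x where "x = 1 + 2 * card (B \<rho>)"
    have "card (B \<rho>) \<le> card {i<..<j}" unfolding B_def by (intro card_mono) auto
    then have "real x \<le> 2 * real (j - i)" using ij by (simp add: x_def)
    then have "(1 - \<phi>) * real x \<le> (1 - \<phi>) * (2 * real (j - i))"
      using phi_less_1 by (intro mult_left_mono) auto
    then have x2: "(1 - \<phi>) * real x \<le> 2" using small by simp
    \<comment> \<open>The denominator \<open>1 + (1 - \<phi>) * real x\<close> is at most 3.\<close>
    have "(1 - \<phi>) * real x / 3 \<le> (1 - \<phi>) * real x / (1 + (1 - \<phi>) * real x)"
      using x2 phi_less_1 by (intro divide_left_mono) (auto intro!: mult_pos_pos add_pos_nonneg)
    also have "\<dots> \<le> 1 - \<phi> ^ x" by (rule one_minus_power_ge)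
    finally have "\<phi> ^ inversions n \<rho> * ((1 - \<phi>) * real x / 3) \<le> \<phi> ^ inversions n \<rho> * (1 - \<phi> ^ x)"
      using phi_nonneg by (intro mult_left_mono) auto
    moreover have "inversions n (\<rho> \<circ> ?t) = inversions n \<rho> + x"
      using inversions_transpose[of \<rho> n i j] ij that by (simp add: A_def B_def x_def)
    ultimately show ?thesis by (simp add: power_add x_def algebra_simps add_divide_distrib diff_divide_distrib)
  qed
  have "(\<Sum>\<rho> | \<rho> permutes {1..n}. \<phi> ^ inversions n \<rho> * (if \<rho> i < \<rho> j then 1 else -1))
    = inv_wt n (\<lambda>\<rho>. \<rho> i < \<rho> j) - inv_wt n (\<lambda>\<rho>. \<not> \<rho> i < \<rho> j)"
  proof -
    define A' where "A' = {\<rho>. \<rho> permutes {1..n} \<and> \<not> \<rho> i < \<rho> j}"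
    have A': "finite A'" unfolding A'_def by (rule finite_permutes_filter)
    have U: "{\<rho>. \<rho> permutes {1..n}} = A \<union> A'" and d: "A \<inter> A' = {}" by (auto simp: A_def A'_def)
    have "(\<Sum>\<rho>\<in>A. \<phi> ^ inversions n \<rho> * (if \<rho> i < \<rho> j then 1 else -1)) = inv_wt n (\<lambda>\<rho>. \<rho> i < \<rho> j)"
      unfolding inv_wt_def A_def by (rule sum.cong) auto
    moreover have "(\<Sum>\<rho>\<in>A'. \<phi> ^ inversions n \<rho> * (if \<rho> i < \<rho> j then 1 else -1)) =
        - inv_wt n (\<lambda>\<rho>. \<not> \<rho> i < \<rho> j)"
      unfolding inv_wt_def A'_def sum_negf[symmetric] by (rule sum.cong) auto
    ultimately show ?thesis unfolding U by (simp add: sum.union_disjoint[OF A A' d])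
  qed
  \<comment> \<open>The permutations with sign -1 are the swaps of those in
    \<open>A\<close>.\<close>
  also have "inv_wt n (\<lambda>\<rho>. \<not> \<rho> i < \<rho> j) = (\<Sum>\<rho>\<in>A. \<phi> ^ inversions n (\<rho> \<circ> ?t))"
  proof -
    have "inv_wt n (\<lambda>\<rho>. \<not> \<rho> i < \<rho> j) = inv_wt n (\<lambda>\<rho>. (\<rho> \<circ> ?t) i < (\<rho> \<circ> ?t) j)"
      using ij by (intro inv_wt_cong) (auto dest: permutes_less_or[where a=i and b=j])
    also have "\<dots> = (\<Sum>\<rho>\<in>A. \<phi> ^ inversions n (\<rho> \<circ> ?t))"
      unfolding inv_wt_def A_def using ij by (intro sum_transpose[where C = "\<lambda>\<rho>. \<rho> i < \<rho> j"]) auto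
    finally show ?thesis .
  qed
  also have "inv_wt n (\<lambda>\<rho>. \<rho> i < \<rho> j) - (\<Sum>\<rho>\<in>A. \<phi> ^ inversions n (\<rho> \<circ> ?t)) =
      (\<Sum>\<rho>\<in>A. \<phi> ^ inversions n \<rho> - \<phi> ^ inversions n (\<rho> \<circ> ?t))"
    unfolding inv_wt_def A_def by (simp add: sum_subtractf)
  also have "\<dots> \<ge> (\<Sum>\<rho>\<in>A. \<phi> ^ inversions n \<rho> * ((1 - \<phi>) / 3 * (1 + 2 * real (card (B \<rho>)))))"
    by (rule sum_mono) (rule per)
  also have "(\<Sum>\<rho>\<in>A. \<phi> ^ inversions n \<rho> * ((1 - \<phi>) / 3 * (1 + 2 * real (card (B \<rho>)))))
     = (1 - \<phi>) / 3 * ((\<Sum>\<rho>\<in>A. \<phi> ^ inversions n \<rho>) + 2 * (\<Sum>\<rho>\<in>A. \<phi> ^ inversions n \<rho> * real (card (B \<rho>))))"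
    by (simp add: sum_distrib_left sum.distrib[symmetric] algebra_simps)
  also have "(\<Sum>\<rho>\<in>A. \<phi> ^ inversions n \<rho>) = inv_wt n (\<lambda>\<rho>. \<rho> i < \<rho> j)" by (simp add: inv_wt_def A_def)
  also have "(\<Sum>\<rho>\<in>A. \<phi> ^ inversions n \<rho> * real (card (B \<rho>))) =
      (\<Sum>l\<in>{i<..<j}. inv_wt n (\<lambda>\<rho>. \<rho> i < \<rho> l \<and> \<rho> l < \<rho> j))"
  proof -
    have card: "real (card (B \<rho>)) = (\<Sum>l\<in>{i<..<j}. of_bool (\<rho> i < \<rho> l \<and> \<rho> l < \<rho> j))" for \<rho>
    proof -
      have "B \<rho> = {i<..<j} \<inter> {l. \<rho> i < \<rho> l \<and> \<rho> l < \<rho> j}" by (auto simp: B_def)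
      then show ?thesis by simp
    qed
    have "(\<Sum>\<rho>\<in>A. \<phi> ^ inversions n \<rho> * real (card (B \<rho>))) =
      (\<Sum>l\<in>{i<..<j}. \<Sum>\<rho>\<in>A. \<phi> ^ inversions n \<rho> * of_bool (\<rho> i < \<rho> l \<and> \<rho> l < \<rho> j))"
      unfolding card sum_distrib_left by (rule sum.swap)
    also have "\<dots> = (\<Sum>l\<in>{i<..<j}. inv_wt n (\<lambda>\<rho>. \<rho> i < \<rho> l \<and> \<rho> l < \<rho> j))"
    proof (intro sum.cong refl)
      fix l
      have "(\<Sum>\<rho>\<in>A. \<phi> ^ inversions n \<rho> * of_bool (\<rho> i < \<rho> l \<and> \<rho> l < \<rho> j)) =
         (\<Sum>\<rho>\<in>A \<inter> {\<rho>. \<rho> i < \<rho> l \<and> \<rho> l < \<rho> j}. \<phi> ^ inversions n \<rho>)"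
        using A by (simp add: sum.inter_restrict of_bool_def if_distrib cong: if_cong)
      also have "A \<inter> {\<rho>. \<rho> i < \<rho> l \<and> \<rho> l < \<rho> j} = {\<rho>. \<rho> permutes {1..n} \<and> \<rho> i < \<rho> l \<and> \<rho> l < \<rho> j}"
        by (auto simp: A_def)
      finally show "(\<Sum>\<rho>\<in>A. \<phi> ^ inversions n \<rho> * of_bool (\<rho> i < \<rho> l \<and> \<rho> l < \<rho> j)) =
         inv_wt n (\<lambda>\<rho>. \<rho> i < \<rho> l \<and> \<rho> l < \<rho> j)" unfolding inv_wt_def .
    qed
    finally show ?thesis .
  qed
  finally have main: "(\<Sum>\<rho> | \<rho> permutes {1..n}. \<phi> ^ inversions n \<rho> * (if \<rho> i < \<rho> j then 1 else -1))
    \<ge> (1 - \<phi>) / 3 * (inv_wt n (\<lambda>\<rho>. \<rho> i < \<rho> j) + 2 * (\<Sum>l\<in>{i<..<j}. inv_wt n (\<lambda>\<rho>. \<rho> i < \<rho> l \<and> \<rho> l < \<rho> j)))" .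
  have "(\<Sum>l\<in>{i<..<j}. inv_Z n / 6) \<le> (\<Sum>l\<in>{i<..<j}. inv_wt n (\<lambda>\<rho>. \<rho> i < \<rho> l \<and> \<rho> l < \<rho> j))"
    using ij by (intro sum_mono inv_wt_sorted_triple) auto
  then have "inv_Z n / 2 + 2 * (real (j - i - 1) * (inv_Z n / 6)) \<le>
     inv_wt n (\<lambda>\<rho>. \<rho> i < \<rho> j) + 2 * (\<Sum>l\<in>{i<..<j}. inv_wt n (\<lambda>\<rho>. \<rho> i < \<rho> l \<and> \<rho> l < \<rho> j))"
    using inv_wt_sorted_pair[OF ij] unfolding sum_constant card_greaterThanLessThan
    by (simp only: Suc_eq_plus1 diff_diff_left)
  \<comment> \<open>Each of the \<open>j - i - 1\<close> intermediate indices contributes at least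
    2/6, and 1/2 + (j - i - 1)/3 \<ge> (j - i)/3. The factor \<delta>/3 from above then yields the
    9.\<close>
  moreover have "inv_Z n * real (j - i) / 3 \<le> inv_Z n / 2 + 2 * (real (j - i - 1) * (inv_Z n / 6))"
  proof -
    define d where "d = j - i - 1"
    have "j - i = Suc d" using ij by (simp add: d_def)
    then show ?thesis using Znn unfolding d_def[symmetric] by (simp add: algebra_simps)
  qed
  ultimately have "(1 - \<phi>) / 3 * (inv_Z n * real (j - i) / 3) \<le> (1 - \<phi>) / 3 * (inv_wt n (\<lambda>\<rho>. \<rho> i < \<rho> j) + 2 * (\<Sum>l\<in>{i<..<j}. inv_wt n (\<lambda>\<rho>. \<rho> i < \<rho> l \<and> \<rho> l < \<rho> j)))"
    using phi_less_1 by (intro mult_left_mono) auto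
  also have "(1 - \<phi>) / 3 * (inv_Z n * real (j - i) / 3) = inv_Z n * ((1 - \<phi>) * real (j - i) / 9)" by simp
  finally show ?thesis using main by linarith
qed

end

section \<open>Discordant pairs\<close>

text \<open>Hardy's inequality for exponent 2. With running averages \<alpha>, the identity a(k) = k
  \<alpha>(k) - (k-1) \<alpha>(k-1) makes the sum of \<alpha>^2 - 2 \<alpha> a nonpositive, and 2
  \<alpha> a \<le> \<alpha>^2 / 2 + 2 a^2.\<close>

lemma hardy_inequality:
  fixes a :: "nat \<Rightarrow> real"
  assumes "\<And>i. a i \<ge> 0"
  shows "(\<Sum>k\<in>{1..n}. ((\<Sum>i\<in>{1..k}. a i) / real k)\<^sup>2) \<le> 4 * (\<Sum>k\<in>{1..n}. (a k)\<^sup>2)"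
proof -
  define A where "A k = (\<Sum>i\<in>{1..k}. a i)" for k
  define \<alpha> where "\<alpha> k = A k / real k" for k
  \<comment> \<open>The remainder at \<open>n\<close> makes the induction close: the step differs
    from equality by a multiple of the square of
    \<open>\<alpha> n - \<alpha> (Suc n)\<close>.\<close>
  have tele: "(\<Sum>k\<in>{1..n}. (\<alpha> k)\<^sup>2 - 2 * (\<alpha> k * a k)) \<le> - (real n * (\<alpha> n)\<^sup>2)" for n
  proof (induction n)
    case (Suc n)
    have a: "a (Suc n) = real (Suc n) * \<alpha> (Suc n) - real n * \<alpha> n"
      by (cases "n = 0") (auto simp: \<alpha>_def A_def)
    have "- (real n * (\<alpha> n)\<^sup>2) + ((\<alpha> (Suc n))\<^sup>2 - 2 * (\<alpha> (Suc n) * a (Suc n))) + real (Suc n) * (\<alpha> (Suc n))\<^sup>2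
       = - (real n * (\<alpha> n - \<alpha> (Suc n))\<^sup>2)"
      unfolding a by (simp add: algebra_simps power2_eq_square)
    also have "\<dots> \<le> 0" by simp
    finally show ?case using Suc by simp
  qed simp
  have "(\<Sum>k\<in>{1..n}. (\<alpha> k)\<^sup>2 - 2 * (\<alpha> k * a k)) \<le> 0"
    using tele[of n] by (smt (verit) mult_nonneg_nonneg of_nat_0_le_iff zero_le_power2)
  moreover have "(\<Sum>k\<in>{1..n}. (\<alpha> k)\<^sup>2 - 2 * (\<alpha> k * a k)) \<ge> (\<Sum>k\<in>{1..n}. (\<alpha> k)\<^sup>2 / 2 - 2 * (a k)\<^sup>2)"
  proof (rule sum_mono)
    fix k
    have "0 \<le> (\<alpha> k - 2 * a k)\<^sup>2" by simp
    then show "(\<alpha> k)\<^sup>2 / 2 - 2 * (a k)\<^sup>2 \<le> (\<alpha> k)\<^sup>2 - 2 * (\<alpha> k * a k)"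
      by (simp add: power2_diff power_mult_distrib)
  qed
  ultimately have "(\<Sum>k\<in>{1..n}. (\<alpha> k)\<^sup>2 / 2 - 2 * (a k)\<^sup>2) \<le> 0" by linarith
  then show ?thesis
    by (simp add: sum_subtractf \<alpha>_def A_def flip: sum_divide_distrib sum_distrib_left)
qed

text \<open>Cauchy-Schwarz in each window: a window holds at most \<open>w\<close> indices, and an
  index lies in at most \<open>w\<close> windows.\<close>

lemma window_sum_squares:
  fixes a :: "nat \<Rightarrow> real"
  shows "(\<Sum>k\<in>{1..n}. (\<Sum>i | i \<in> {1..n} \<and> i < k \<and> k \<le> i + w. a i)\<^sup>2) \<le> (real w)\<^sup>2 * (\<Sum>i\<in>{1..n}. (a i)\<^sup>2)"
proof -
  have "(\<Sum>k\<in>{1..n}. (\<Sum>i | i \<in> {1..n} \<and> i < k \<and> k \<le> i + w. a i)\<^sup>2)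
     \<le> (\<Sum>k\<in>{1..n}. real w * (\<Sum>i | i \<in> {1..n} \<and> i < k \<and> k \<le> i + w. (a i)\<^sup>2))"
  proof (rule sum_mono)
    fix k
    let ?I = "{i. i \<in> {1..n} \<and> i < k \<and> k \<le> i + w}"
    have "(\<Sum>i\<in>?I. a i)\<^sup>2 \<le> real (card ?I) * (\<Sum>i\<in>?I. (a i)\<^sup>2)"
      using Cauchy_Schwarz_ineq_sum[of a "\<lambda>_. 1" ?I] by (simp add: mult.commute)
    also have "card ?I \<le> card {k - w..<k}" by (intro card_mono) auto
    then have "real (card ?I) * (\<Sum>i\<in>?I. (a i)\<^sup>2) \<le> real w * (\<Sum>i\<in>?I. (a i)\<^sup>2)"
      by (intro mult_right_mono sum_nonneg) auto
    finally show "(\<Sum>i\<in>?I. a i)\<^sup>2 \<le> real w * (\<Sum>i\<in>?I. (a i)\<^sup>2)" .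
  qed
  also have "\<dots> = real w * (\<Sum>k\<in>{1..n}. \<Sum>i | i \<in> {1..n} \<and> i < k \<and> k \<le> i + w. (a i)\<^sup>2)"
    by (simp add: sum_distrib_left)
  also have "(\<Sum>k\<in>{1..n}. \<Sum>i | i \<in> {1..n} \<and> i < k \<and> k \<le> i + w. (a i)\<^sup>2)
      = (\<Sum>i\<in>{1..n}. \<Sum>k | k \<in> {1..n} \<and> i < k \<and> k \<le> i + w. (a i)\<^sup>2)"
    by (rule sum.swap_restrict) auto
  also have "\<dots> \<le> (\<Sum>i\<in>{1..n}. real w * (a i)\<^sup>2)"
  proof (rule sum_mono)
    fix i
    have "card {k. k \<in> {1..n} \<and> i < k \<and> k \<le> i + w} \<le> card {i<..i + w}" by (intro card_mono) auto
    then show "(\<Sum>k | k \<in> {1..n} \<and> i < k \<and> k \<le> i + w. (a i)\<^sup>2) \<le> real w * (a i)\<^sup>2"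
      by (simp add: mult_right_mono)
  qed
  finally show ?thesis
    by (simp add: power2_eq_square mult_left_mono mult.assoc flip: sum_distrib_left)
qed

section \<open>Discordance counts and squared displacements\<close>

definition disc :: "nat \<Rightarrow> (nat \<Rightarrow> nat) \<Rightarrow> (nat \<times> nat) set" where
  "disc n y = {(i, j). i \<in> {1..n} \<and> j \<in> {1..n} \<and> i < j \<and> y j < y i}"

definition sqdist :: "nat \<Rightarrow> (nat \<Rightarrow> nat) \<Rightarrow> real" where
  "sqdist n y = (\<Sum>i\<in>{1..n}. (real i - real (y i))\<^sup>2)"

text \<open>In the application \<open>y\<close> is \<open>inv \<sigma>s \<circ> \<pi>s\<close>:
  elements are named by their position in \<open>\<pi>s\<close>, \<open>disc\<close> holds the
  discordant pairs, and these are the neighbours in the graph they form.\<close>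

definition disc_nbrs :: "nat \<Rightarrow> (nat \<Rightarrow> nat) \<Rightarrow> nat \<Rightarrow> nat set" where
  "disc_nbrs n y i = {j. (i, j) \<in> disc n y \<or> (j, i) \<in> disc n y}"

lemma finite_disc: "finite (disc n y)"
  by (rule finite_subset[of _ "{1..n} \<times> {1..n}"]) (auto simp: disc_def)

lemma disc_nbrs_subset: "disc_nbrs n y i \<subseteq> {1..n}"
  by (auto simp: disc_nbrs_def disc_def)

lemma card_smaller_values: "y permutes {1..n} \<Longrightarrow> i \<in> {1..n} \<Longrightarrow> card {a \<in> {1..n}. y a < y i} = y i - 1"
proof -
  assume y: "y permutes {1..n}" and i: "i \<in> {1..n}"
  have yi: "y i \<in> {1..n}" using y i by (simp add: permutes_in_image del: atLeastAtMost_iff)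
  have "y ` {a \<in> {1..n}. y a < y i} = {1..<y i}"
  proof safe
    fix a assume "a \<in> {1..n}" "y a < y i"
    then show "y a \<in> {1..<y i}" using permutes_in_image[OF y, of a] by auto
  next
    fix x assume x: "x \<in> {1..<y i}"
    then have "x \<in> y ` {1..n}" using yi permutes_image[OF y] by auto
    then show "x \<in> y ` {a \<in> {1..n}. y a < y i}" using x by auto
  qed
  moreover have "inj_on y A" for A using permutes_inj[OF y] by (meson inj_on_subset subset_UNIV)
  ultimately show ?thesis by (metis card_image card_atLeastLessThan)
qed

text \<open>Since \<Sum> (y i)^2 = \<Sum> i^2, the left side is 2 \<Sum> i (i - y i). Here i - y i
  counts the discordant partners of \<open>i\<close> to its left minus those to its right, so a
  discordant pair (i, j) contributes j - i.\<close>

lemma sqdist_eq_sum_disc: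
  assumes y: "y permutes {1..n}"
  shows "sqdist n y = 2 * (\<Sum>(i, j)\<in>disc n y. real (j - i))"
proof -
  define S where "S = {1..n}"
  have fin: "finite S" by (simp add: S_def)
  have yi: "real (y i) = 1 + (\<Sum>a\<in>S. of_bool (y a < y i))" if "i \<in> S" "y permutes S" for i y
  proof -
    have "y i \<ge> 1" using that permutes_in_image[of y S i] by (auto simp: S_def)
    moreover have "real (card {a \<in> S. y a < y i}) = (\<Sum>a\<in>S. of_bool (y a < y i))"
      using fin by (simp add: Int_def)
    ultimately show ?thesis using card_smaller_values[of y n i] that by (auto simp: S_def)
  qed
  have i: "real i = 1 + (\<Sum>a\<in>S. of_bool (a < i))" if "i \<in> S" for i
    using yi[of i id] that by (simp add: permutes_id)
  have "(\<Sum>i\<in>S. (real (y i))\<^sup>2) = (\<Sum>i\<in>S. (real i)\<^sup>2)"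
    using sum.permute[of y S "\<lambda>i. (real i)\<^sup>2"] y by (simp add: S_def o_def)
  then have "sqdist n y = 2 * (\<Sum>i\<in>S. real i * (real i - real (y i)))"
    unfolding sqdist_def S_def[symmetric] power2_diff right_diff_distrib sum.distrib sum_subtractf
    by (simp add: mult.assoc flip: sum_distrib_left power2_eq_square)
  also have "(\<Sum>i\<in>S. real i * (real i - real (y i))) =
     (\<Sum>i\<in>S. \<Sum>a\<in>S. real i * (of_bool (a < i) - of_bool (y a < y i)))"
    using i yi y by (intro sum.cong refl) (simp add: S_def sum_subtractf flip: sum_distrib_left)
  \<comment> \<open>The indicators cancel for every \<open>a\<close> that is ordered with
    \<open>i\<close> alike by both rankings.\<close>
  also have "\<dots> = (\<Sum>i\<in>S. \<Sum>a\<in>S. real i * of_bool (a < i \<and> y i < y a) - real i * of_bool (i < a \<and> y a < y i))"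
    using permutes_less_or[OF y] by (intro sum.cong refl) (auto simp: not_less le_less dest: injD[OF permutes_inj[OF y]])
  also have "\<dots> = (\<Sum>i\<in>S. \<Sum>a\<in>S. real i * of_bool (a < i \<and> y i < y a)) - (\<Sum>a\<in>S. \<Sum>i\<in>S. real i * of_bool (i < a \<and> y a < y i))"
    by (simp add: sum_subtractf) (rule sum.swap)
  also have "\<dots> = (\<Sum>j\<in>S. \<Sum>i\<in>S. (real j - real i) * of_bool (i < j \<and> y j < y i))"
    by (simp add: sum_subtractf left_diff_distrib)
  also have "\<dots> = (\<Sum>i\<in>S. \<Sum>j\<in>S. if i < j \<and> y j < y i then real (j - i) else 0)"
    by (subst sum.swap) (auto intro!: sum.cong simp: of_nat_diff)
  also have "\<dots> = (\<Sum>x\<in>S\<times>S. if fst x < snd x \<and> y (snd x) < y (fst x) then real (snd x - fst x) else 0)"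
    by (simp only: sum.cartesian_product case_prod_unfold)
  also have "\<dots> = (\<Sum>x\<in>{x \<in> S \<times> S. fst x < snd x \<and> y (snd x) < y (fst x)}. real (snd x - fst x))"
    by (rule sum.inter_filter[symmetric]) (simp add: fin)
  also have "{x \<in> S \<times> S. fst x < snd x \<and> y (snd x) < y (fst x)} = disc n y"
    unfolding disc_def S_def by auto
  finally show ?thesis by (simp only: case_prod_unfold)
qed

text \<open>j - i = (j - y j) + (y j - y i) + (y i - i), and the middle term is negative.\<close>

lemma disc_distance_less:
  assumes "(i, j) \<in> disc n y"
  shows "real (j - i) < \<bar>real i - real (y i)\<bar> + \<bar>real j - real (y j)\<bar>"
proof -
  have "i < j" "y j < y i" using assms by (auto simp: disc_def)
  then show ?thesis by (simp add: of_nat_diff)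
qed

text \<open>A discordant triple lies within four times the largest displacement of one of its members, so
  counting triples by that member gives the bound.\<close>

lemma sum_disc_nbrs_squares_le:
  "(\<Sum>i\<in>{1..n}. (real (card (disc_nbrs n y i)))\<^sup>2) \<le> 243 * sqdist n y"
proof -
  define S where "S = {1..n}"
  define w where "w i = \<bar>int i - int (y i)\<bar>" for i
  define B where "B m = {i \<in> S. \<bar>int i - int m\<bar> \<le> 4 * w m}" for m
  define S' where "S' = {m \<in> S. w m \<noteq> 0}"
  let ?N = "disc_nbrs n y"
  have fin: "finite S" "finite S'" "finite (B m)" for m by (auto simp: S_def S'_def B_def)
  have N: "i \<in> S \<and> j \<in> S \<and> \<bar>int i - int j\<bar> < w i + w j" if "j \<in> ?N i" for i j
    using that by (auto simp: disc_nbrs_def disc_def S_def w_def)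
  define U where "U m = ({m} \<times> B m \<times> B m) \<union> (B m \<times> {m} \<times> B m) \<union> (B m \<times> B m \<times> {m})" for m
  \<comment> \<open>If \<open>m\<close> has the largest displacement, a neighbour is less than
    \<open>2 * w m\<close> away from \<open>i\<close>, so the two neighbours are less than
    \<open>4 * w m\<close> apart. In particular \<open>w m\<close> is not 0.\<close>
  have "(SIGMA i:S. ?N i \<times> ?N i) \<subseteq> (\<Union>m\<in>S'. U m)"
  proof
    fix x assume x: "x \<in> (SIGMA i:S. ?N i \<times> ?N i)"
    then obtain i j k where xe: "x = (i, j, k)" "j \<in> ?N i" "k \<in> ?N i" by auto
    note * = N[OF xe(2)] N[OF xe(3)]
    consider "w j \<le> w i" "w k \<le> w i" | "w i \<le> w j" "w k \<le> w j" | "w i \<le> w k" "w j \<le> w k"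
      by linarith
    then show "x \<in> (\<Union>m\<in>S'. U m)"
    proof cases
      case 1
      then have "i \<in> S'" "x \<in> U i" using * xe by (auto simp: S'_def U_def B_def)
      then show ?thesis by blast
    next
      case 2
      then have "j \<in> S'" "x \<in> U j" using * xe by (auto simp: S'_def U_def B_def)
      then show ?thesis by blast
    next
      case 3
      then have "k \<in> S'" "x \<in> U k" using * xe by (auto simp: S'_def U_def B_def)
      then show ?thesis by blast
    qed
  qed
  then have "card (SIGMA i:S. ?N i \<times> ?N i) \<le> card (\<Union>m\<in>S'. U m)"
    using fin by (intro card_mono) (auto simp: U_def)
  also have "\<dots> \<le> (\<Sum>m\<in>S'. card (U m))" by (rule card_UN_le) (rule fin)
  finally have "real (card (SIGMA i:S. ?N i \<times> ?N i)) \<le> real (\<Sum>m\<in>S'. card (U m))" by linarith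
  also have "\<dots> = (\<Sum>m\<in>S'. real (card (U m)))" by simp
  also have "\<dots> \<le> (\<Sum>m\<in>S'. 243 * (real m - real (y m))\<^sup>2)"
  proof (rule sum_mono)
    fix m assume m: "m \<in> S'"
    have "int ` B m \<subseteq> {int m - 4 * w m..int m + 4 * w m}" by (auto simp: B_def)
    then have "card (int ` B m) \<le> card {int m - 4 * w m..int m + 4 * w m}" by (intro card_mono) auto
    also have "card (int ` B m) = card (B m)" by (rule card_image) simp
    also have "card {int m - 4 * w m..int m + 4 * w m} = nat (8 * w m + 1)" by simp
    \<comment> \<open>With three places for \<open>m\<close> in the triple this gives 243 = 3 * 9 *
      9.\<close>
    also have "\<dots> \<le> nat (9 * w m)"
    proof -
      have "w m \<ge> 1" using m by (auto simp: S'_def w_def)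
      then show ?thesis by simp
    qed
    finally have b: "card (B m) \<le> nat (9 * w m)" .
    have "card (U m) \<le> card ({m} \<times> B m \<times> B m) + card (B m \<times> {m} \<times> B m) + card (B m \<times> B m \<times> {m})"
      unfolding U_def by (meson add_le_mono1 card_Un_le order_trans)
    also have "\<dots> = 3 * (card (B m) * card (B m))" by (simp add: card_cartesian_product)
    also have "\<dots> \<le> 3 * (nat (9 * w m) * nat (9 * w m))" by (intro mult_le_mono order_refl b)
    finally have "real (card (U m)) \<le> real (3 * (nat (9 * w m) * nat (9 * w m)))" by linarith
    also have "\<dots> = 243 * (of_int (w m))\<^sup>2" by (simp add: w_def power2_eq_square)
    also have "(of_int (w m))\<^sup>2 = (real m - real (y m))\<^sup>2" by (simp add: w_def)
    finally show "real (card (U m)) \<le> 243 * (real m - real (y m))\<^sup>2" .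
  qed
  also have "\<dots> \<le> (\<Sum>m\<in>S. 243 * (real m - real (y m))\<^sup>2)"
    by (intro sum_mono2) (auto simp: S_def S'_def)
  also have "\<dots> = 243 * sqdist n y" by (simp add: sqdist_def S_def sum_distrib_left)
  also have "card (SIGMA i:S. ?N i \<times> ?N i) = (\<Sum>i\<in>S. card (?N i \<times> ?N i))"
    using finite_subset[OF disc_nbrs_subset] fin by (intro card_SigmaI) auto
  finally show ?thesis by (simp add: S_def card_cartesian_product power2_eq_square)
qed

section \<open>Moments of the sum of discordant signs\<close>

definition disc_sum :: "nat \<Rightarrow> (nat \<Rightarrow> nat) \<Rightarrow> (nat \<Rightarrow> nat) \<Rightarrow> real" where
  "disc_sum n y \<rho> = (\<Sum>(i, j)\<in>disc n y. if \<rho> i < \<rho> j then 1 else -1)"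

lemma displacement_le_sqrt_sqdist: "i \<in> {1..n} \<Longrightarrow> \<bar>real i - real (y i)\<bar> \<le> sqrt (sqdist n y)"
proof -
  assume "i \<in> {1..n}"
  then have "(real i - real (y i))\<^sup>2 \<le> sqdist n y"
    unfolding sqdist_def by (intro member_le_sum) auto
  then show ?thesis by (metis real_sqrt_abs real_sqrt_le_iff)
qed

text \<open>The pairs that do not contain \<open>k\<close> but whose conditional mean sign can still
  move when entry \<open>k\<close> is revealed.\<close>

definition crossing :: "nat \<Rightarrow> (nat \<Rightarrow> nat) \<Rightarrow> nat \<Rightarrow> (nat \<times> nat) set" where
  "crossing n y k = {(i, j) \<in> disc n y. i < k \<and> k < j}"

lemma card_crossing_le:
  assumes "\<And>i j. (i, j) \<in> crossing n y k \<Longrightarrow> i \<in> I" "finite I"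
  shows "card (crossing n y k) \<le> (\<Sum>i\<in>I. card (disc_nbrs n y i))"
proof -
  have fin: "finite (disc_nbrs n y i)" for i by (rule finite_subset[OF disc_nbrs_subset]) simp
  have "crossing n y k \<subseteq> (SIGMA i:I. disc_nbrs n y i)"
    using assms by (auto simp: crossing_def disc_nbrs_def)
  then have "card (crossing n y k) \<le> card (SIGMA i:I. disc_nbrs n y i)"
    using assms fin by (intro card_mono) auto
  then show ?thesis using assms fin by (simp add: card_SigmaI)
qed

lemma card_disc_containing_le:
  "card {(i, j) \<in> disc n y. i = k \<or> j = k} \<le> card (disc_nbrs n y k)"
proof -
  have "{(i, j) \<in> disc n y. i = k \<or> j = k} \<subseteq> (\<lambda>j. (min j k, max j k)) ` disc_nbrs n y k"
  proof clarify
    fix i j assume ij: "(i, j) \<in> disc n y" "i = k \<or> j = k"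
    have "i < j" using ij by (auto simp: disc_def)
    with ij show "(i, j) \<in> (\<lambda>j. (min j k, max j k)) ` disc_nbrs n y k"
      by (intro image_eqI[of _ _ "if i = k then j else i"]) (auto simp: disc_nbrs_def)
  qed
  moreover have fin: "finite (disc_nbrs n y k)" by (rule finite_subset[OF disc_nbrs_subset]) simp
  ultimately show ?thesis by (meson surj_card_le)
qed

context subunit
begin

lemma disc_distance_small:
  assumes "(1 - \<phi>) * sqrt (sqdist n y) \<le> 1 / 2" "(i, j) \<in> disc n y"
  shows "(1 - \<phi>) * real (j - i) \<le> 1"
proof -
  have "real (j - i) \<le> 2 * sqrt (sqdist n y)"
    using disc_distance_less[OF assms(2)] displacement_le_sqrt_sqdist[of i n y]
      displacement_le_sqrt_sqdist[of j n y] assms(2) by (auto simp: disc_def)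
  then have "(1 - \<phi>) * real (j - i) \<le> (1 - \<phi>) * (2 * sqrt (sqdist n y))"
    using phi_less_1 by (intro mult_left_mono) auto
  then show ?thesis using assms(1) by simp
qed

text \<open>Crossing pairs are counted by their left end in two ways: for the term with \<delta> it
  lies in a window of length about 1/\<delta> before \<open>k\<close>, for the term with 1/k it lies
  in {1..k} and Hardy's inequality applies. Both reduce to
  \<open>sum_disc_nbrs_squares_le\<close>.\<close>

lemma sum_increment_bounds_le:
  assumes "(1 - \<phi>) * sqrt (sqdist n y) \<le> 1 / 2"
  shows "(\<Sum>k\<in>{1..n}. (2 * real (card (disc_nbrs n y k)) +
      6 * ((1 - \<phi>) + 1 / real k) * real (card (crossing n y k)))\<^sup>2) \<le> 134136 * sqdist n y"
proof -
  define a where "a k = real (card (disc_nbrs n y k))" for k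
  define X where "X k = real (card (crossing n y k))" for k
  define A where "A = (\<Sum>k\<in>{1..n}. (a k)\<^sup>2)"
  \<comment> \<open>The window length: no discordant pair is longer than 1/\<delta>, by
    \<open>disc_distance_small\<close>.\<close>
  define w where "w = nat \<lfloor>1 / (1 - \<phi>)\<rfloor>"
  have A0: "A \<ge> 0" unfolding A_def by (intro sum_nonneg) auto
  have w: "(1 - \<phi>) * real w \<le> 1"
  proof -
    have "real w \<le> 1 / (1 - \<phi>)" unfolding w_def using phi_less_1 by (simp add: of_nat_nat)
    then show ?thesis using phi_less_1 by (simp add: field_simps)
  qed
  have cross: "1 \<le> i \<and> i \<le> n \<and> i < k \<and> k \<le> i + w" if "(i, j) \<in> crossing n y k" for i j k
  proof -
    have ij: "(i, j) \<in> disc n y" "i < k" "k < j" using that by (auto simp: crossing_def)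
    have "real (j - i) \<le> 1 / (1 - \<phi>)"
      using disc_distance_small[OF assms ij(1)] phi_less_1 by (simp add: field_simps)
    then have "j - i \<le> w" unfolding w_def by (simp add: le_nat_floor)
    then show ?thesis using ij by (auto simp: disc_def)
  qed
  have "X k \<le> (\<Sum>i | i \<in> {1..n} \<and> i < k \<and> k \<le> i + w. a i)" for k
    unfolding X_def a_def of_nat_sum[symmetric] of_nat_le_iff
    by (intro card_crossing_le) (auto dest: cross)
  then have "(\<Sum>k\<in>{1..n}. (X k)\<^sup>2) \<le> (\<Sum>k\<in>{1..n}. (\<Sum>i | i \<in> {1..n} \<and> i < k \<and> k \<le> i + w. a i)\<^sup>2)"
    by (intro sum_mono power_mono) (auto simp: X_def)
  also have "\<dots> \<le> (real w)\<^sup>2 * A" unfolding A_def by (rule window_sum_squares)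
  finally have "(1 - \<phi>)\<^sup>2 * (\<Sum>k\<in>{1..n}. (X k)\<^sup>2) \<le> (1 - \<phi>)\<^sup>2 * ((real w)\<^sup>2 * A)"
    by (intro mult_left_mono) auto
  also have "\<dots> = ((1 - \<phi>) * real w)\<^sup>2 * A" by (simp add: power_mult_distrib)
  also have "\<dots> \<le> 1 * A" using w phi_less_1 A0 by (intro mult_right_mono power_le_one) auto
  finally have 1: "(1 - \<phi>)\<^sup>2 * (\<Sum>k\<in>{1..n}. (X k)\<^sup>2) \<le> A" by simp
  have "X k \<le> (\<Sum>i\<in>{1..k}. a i)" for k
    unfolding X_def a_def of_nat_sum[symmetric] of_nat_le_iff
    by (intro card_crossing_le) (auto dest: cross)
  then have "(\<Sum>k\<in>{1..n}. (X k / real k)\<^sup>2) \<le> (\<Sum>k\<in>{1..n}. ((\<Sum>i\<in>{1..k}. a i) / real k)\<^sup>2)"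
    by (intro sum_mono power_mono divide_right_mono) (auto simp: X_def)
  also have "\<dots> \<le> 4 * A" unfolding A_def by (rule hardy_inequality) (simp add: a_def)
  finally have 2: "(\<Sum>k\<in>{1..n}. (X k / real k)\<^sup>2) \<le> 4 * A" .
  \<comment> \<open>The square of a sum of three terms is at most three times the sum of squares: 12
    = 3 * 4 and 108 = 3 * 36.\<close>
  have "(\<Sum>k\<in>{1..n}. (2 * a k + 6 * ((1 - \<phi>) + 1 / real k) * X k)\<^sup>2)
     \<le> (\<Sum>k\<in>{1..n}. 12 * (a k)\<^sup>2 + 108 * ((1 - \<phi>)\<^sup>2 * (X k)\<^sup>2) + 108 * (X k / real k)\<^sup>2)"
  proof (rule sum_mono)
    fix k
    have sq: "(x + y + z)\<^sup>2 \<le> 3 * (x\<^sup>2 + y\<^sup>2 + z\<^sup>2)" for x y z :: real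
    proof -
      have "0 \<le> (x - y)\<^sup>2 + (y - z)\<^sup>2 + (x - z)\<^sup>2" by simp
      then show ?thesis by (simp add: power2_eq_square algebra_simps)
    qed
    have "2 * a k + 6 * ((1 - \<phi>) + 1 / real k) * X k = 2 * a k + 6 * ((1 - \<phi>) * X k) + 6 * (X k / real k)"
      by (simp add: algebra_simps add_divide_distrib)
    then show "(2 * a k + 6 * ((1 - \<phi>) + 1 / real k) * X k)\<^sup>2
        \<le> 12 * (a k)\<^sup>2 + 108 * ((1 - \<phi>)\<^sup>2 * (X k)\<^sup>2) + 108 * (X k / real k)\<^sup>2"
      using sq[of "2 * a k" "6 * ((1 - \<phi>) * X k)" "6 * (X k / real k)"]
      by (simp only: power_mult_distrib) simp
  qed
  also have "\<dots> = 12 * A + 108 * ((1 - \<phi>)\<^sup>2 * (\<Sum>k\<in>{1..n}. (X k)\<^sup>2)) + 108 * (\<Sum>k\<in>{1..n}. (X k / real k)\<^sup>2)"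
    unfolding A_def sum.distrib sum_distrib_left by simp
  \<comment> \<open>552 = 12 + 108 + 108 * 4, and 552 * 243 = 134136.\<close>
  also have "\<dots> \<le> 552 * A" using 1 2 by linarith
  also have "\<dots> \<le> 552 * (243 * sqdist n y)"
    unfolding A_def a_def using sum_disc_nbrs_squares_le[of n y] by simp
  finally show ?thesis by (simp add: a_def X_def)
qed

text \<open>\<open>F k\<close> is the mean of \<open>disc_sum\<close> given the first
  \<open>k\<close> code entries, a martingale. Pairs containing \<open>k\<close> move by at most 2
  and pairs crossing \<open>k\<close> by at most 6 times a weight, which gives the increment bound
  \<open>c\<close>.\<close>

lemma disc_sum_moments:
  assumes small: "(1 - \<phi>) * sqrt (sqdist n y) \<le> 1 / 2"
  obtains m where
    "(\<Sum>\<rho> | \<rho> permutes {1..n}. \<phi> ^ inversions n \<rho> * disc_sum n y \<rho>) = inv_Z n * m"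
    "(\<Sum>\<rho> | \<rho> permutes {1..n}. \<phi> ^ inversions n \<rho> * (disc_sum n y \<rho> - m) ^ 4)
        \<le> inv_Z n * (4 * (134136 * sqdist n y)\<^sup>2)"
proof -
  define F where "F k v = (\<Sum>(i, j)\<in>disc n y. proj_sign i j k v)" for k v
  define c where "c k = 2 * real (card (disc_nbrs n y k)) +
      6 * ((1 - \<phi>) + 1 / real k) * real (card (crossing n y k))" for k
  define m where "m = F 0 (\<lambda>_. undefined)"
  have mart: "(\<Sum>u<Suc k. geom_wt (Suc k) u * F (Suc k) (v(Suc k := u))) = F k v" for k v
  proof -
    have "(\<Sum>u<Suc k. geom_wt (Suc k) u * F (Suc k) (v(Suc k := u))) =
      (\<Sum>(i, j)\<in>disc n y. \<Sum>u<Suc k. geom_wt (Suc k) u * proj_sign i j (Suc k) (v(Suc k := u)))"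
      unfolding F_def sum_distrib_left case_prod_unfold by (rule sum.swap)
    also have "\<dots> = F k v" unfolding F_def
      by (intro sum.cong refl) (auto simp: disc_def proj_sign_martingale simp del: sum.lessThan_Suc)
    finally show ?thesis .
  qed
  have bnd: "\<bar>F (Suc k) (v(Suc k := u)) - F k v\<bar> \<le> c (Suc k)" for k v u
  proof -
    let ?K = "Suc k"
    let ?Q = "6 * geom_wt (Suc ?K) 0"
    \<comment> \<open>The increment at \<open>Suc k\<close> involves the weight with index
      \<open>Suc (Suc k)\<close>; enlarging the reciprocal aligns it with the index of
      \<open>c\<close>.\<close>
    have Q: "?Q \<le> 6 * ((1 - \<phi>) + 1 / real ?K)"
    proof -
      have "1 / real (Suc ?K) \<le> 1 / real ?K" by (simp add: field_simps)
      then show ?thesis using geom_wt_0_le[of "Suc ?K"] by simp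
    qed
    have "\<bar>F (Suc k) (v(Suc k := u)) - F k v\<bar> \<le>
       (\<Sum>(i, j)\<in>disc n y. \<bar>proj_sign i j ?K (v(?K := u)) - proj_sign i j k v\<bar>)"
      unfolding F_def sum_subtractf[symmetric] case_prod_unfold by (rule sum_abs)
    also have "\<dots> \<le> (\<Sum>(i, j)\<in>disc n y. 2 * of_bool (i = ?K \<or> j = ?K) + ?Q * of_bool (i < ?K \<and> ?K < j))"
    proof (rule sum_mono, clarify)
      fix i j assume ij: "(i, j) \<in> disc n y"
      then have "0 < i" "i < j" by (auto simp: disc_def)
      from proj_sign_increment[OF this disc_distance_small[OF small ij], of k v u]
      show "\<bar>proj_sign i j ?K (v(?K := u)) - proj_sign i j k v\<bar> \<le> 2 * of_bool (i = ?K \<or> j = ?K) + ?Q * of_bool (i < ?K \<and> ?K < j)"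
        by (auto split: if_splits)
    qed
    also have "\<dots> = 2 * real (card {(i, j) \<in> disc n y. i = ?K \<or> j = ?K}) + ?Q * real (card (crossing n y ?K))"
    proof -
      have "{x \<in> disc n y. fst x = ?K \<or> snd x = ?K} = {(i, j) \<in> disc n y. i = ?K \<or> j = ?K}"
        "{x \<in> disc n y. fst x < ?K \<and> ?K < snd x} = crossing n y ?K"
        by (auto simp: crossing_def)
      moreover have "(\<Sum>x\<in>disc n y. of_bool (P x)) = real (card {x \<in> disc n y. P x})" for P
        using finite_disc[of n y] by (simp add: Int_def)
      ultimately show ?thesis
        by (simp only: case_prod_unfold sum.distrib sum_distrib_left[symmetric])
    qed
    also have "\<dots> \<le> 2 * real (card (disc_nbrs n y ?K)) + 6 * ((1 - \<phi>) + 1 / real ?K) * real (card (crossing n y ?K))"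
      using card_disc_containing_le[of n y ?K] by (intro add_mono mult_right_mono Q) auto
    finally show ?thesis by (simp add: c_def)
  qed
  \<comment> \<open>Once all entries are revealed the conditional mean is the sum itself.\<close>
  have FT: "F n (code n \<rho>) = disc_sum n y \<rho>" if "\<rho> permutes {1..n}" for \<rho>
    unfolding F_def disc_sum_def using that
    by (intro sum.cong refl) (auto simp: disc_def proj_sign_def code_sign_code)
  note M = martingale_moments[of n F c m, OF mart bnd m_def]
  show ?thesis
  proof
    have "(\<Sum>\<rho> | \<rho> permutes {1..n}. \<phi> ^ inversions n \<rho> * disc_sum n y \<rho>) =
       (\<Sum>\<rho> | \<rho> permutes {1..n}. \<phi> ^ inversions n \<rho> * F n (code n \<rho>))"
      by (intro sum.cong) (auto simp: FT)
    then show "(\<Sum>\<rho> | \<rho> permutes {1..n}. \<phi> ^ inversions n \<rho> * disc_sum n y \<rho>) = inv_Z n * m"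
      by (simp only: sum_permutes_eq_code_expect M(1))
    have "(\<Sum>\<rho> | \<rho> permutes {1..n}. \<phi> ^ inversions n \<rho> * (disc_sum n y \<rho> - m) ^ 4) =
       (\<Sum>\<rho> | \<rho> permutes {1..n}. \<phi> ^ inversions n \<rho> * (F n (code n \<rho>) - m) ^ 4)"
      by (intro sum.cong) (auto simp: FT)
    also have "\<dots> = inv_Z n * code_expect n (\<lambda>v. (F n v - m) ^ 4)"
      by (rule sum_permutes_eq_code_expect)
    also have "\<dots> \<le> inv_Z n * (4 * (\<Sum>k\<in>{1..n}. (c k)\<^sup>2)\<^sup>2)"
      using M(2) by (intro mult_left_mono) (auto simp: inv_Z_def phi_nonneg intro!: sum_nonneg)
    also have "\<dots> \<le> inv_Z n * (4 * (134136 * sqdist n y)\<^sup>2)"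
      using sum_increment_bounds_le[OF small] unfolding c_def
      by (intro mult_left_mono power_mono) (auto simp: inv_Z_def phi_nonneg intro!: sum_nonneg)
    finally show "(\<Sum>\<rho> | \<rho> permutes {1..n}. \<phi> ^ inversions n \<rho> * (disc_sum n y \<rho> - m) ^ 4)
        \<le> inv_Z n * (4 * (134136 * sqdist n y)\<^sup>2)" .
  qed
qed

text \<open>\<open>expected_sign_ge\<close> is summed over the discordant pairs, whose lengths add
  up to half of \<open>sqdist\<close>; hence 18 = 9 * 2.\<close>

lemma disc_sum_mean_ge:
  assumes y: "y permutes {1..n}" and small: "(1 - \<phi>) * sqrt (sqdist n y) \<le> 1 / 2"
  shows "(\<Sum>\<rho> | \<rho> permutes {1..n}. \<phi> ^ inversions n \<rho> * disc_sum n y \<rho>) \<ge> inv_Z n * ((1 - \<phi>) * sqdist n y / 18)"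
proof -
  have "inv_Z n * ((1 - \<phi>) * sqdist n y / 18) = (\<Sum>(i, j)\<in>disc n y. inv_Z n * ((1 - \<phi>) * real (j - i) / 9))"
    unfolding sqdist_eq_sum_disc[OF y] by (simp add: sum_distrib_left sum_divide_distrib case_prod_unfold)
  also have "\<dots> \<le> (\<Sum>(i, j)\<in>disc n y. \<Sum>\<rho> | \<rho> permutes {1..n}. \<phi> ^ inversions n \<rho> * (if \<rho> i < \<rho> j then 1 else -1))"
  proof (rule sum_mono, clarify)
    fix i j assume ij: "(i, j) \<in> disc n y"
    then show "inv_Z n * ((1 - \<phi>) * real (j - i) / 9) \<le>
      (\<Sum>\<rho> | \<rho> permutes {1..n}. \<phi> ^ inversions n \<rho> * (if \<rho> i < \<rho> j then 1 else -1))"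
      using disc_distance_small[OF small ij] by (intro expected_sign_ge) (auto simp: disc_def)
  qed
  also have "\<dots> = (\<Sum>\<rho> | \<rho> permutes {1..n}. \<phi> ^ inversions n \<rho> * disc_sum n y \<rho>)"
    unfolding disc_sum_def sum_distrib_left case_prod_unfold by (rule sum.swap)
  finally show ?thesis .
qed

end

section \<open>Relabelling\<close>

definition kt :: "nat \<Rightarrow> (nat \<Rightarrow> nat) \<Rightarrow> (nat \<Rightarrow> nat) \<Rightarrow> nat" where
  "kt n r s = card {(i, j). i \<in> {1..n} \<and> j \<in> {1..n} \<and> i < j \<and> (r i < r j) \<noteq> (s i < s j)}"

lemma kt_eq_sum:
  "int (kt n r s) = (\<Sum>i\<in>{1..n}. \<Sum>j\<in>{1..n}. of_bool (i < j) * of_bool ((r i < r j) \<noteq> (s i < s j)))"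
proof -
  have "{(i, j). i \<in> {1..n} \<and> j \<in> {1..n} \<and> i < j \<and> (r i < r j) \<noteq> (s i < s j)} =
    {x \<in> {1..n} \<times> {1..n}. fst x < snd x \<and> (r (fst x) < r (snd x)) \<noteq> (s (fst x) < s (snd x))}"
    by auto
  then have "int (kt n r s) = (\<Sum>x\<in>{1..n} \<times> {1..n}.
      of_bool (fst x < snd x \<and> (r (fst x) < r (snd x)) \<noteq> (s (fst x) < s (snd x))))"
    unfolding kt_def by (simp add: Int_def)
  then show ?thesis
    unfolding sum.cartesian_product case_prod_unfold of_bool_conj .
qed

text \<open>Relabelling may reverse \<open>i < j\<close>, so the count is first doubled to a
  symmetric sum over ordered pairs, which can be reindexed along \<open>t\<close>.\<close>

lemma kt_compose:
  assumes r: "r permutes {1..n}" and s: "s permutes {1..n}" and t: "t permutes {1..n}"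
  shows "kt n (r \<circ> t) (s \<circ> t) = kt n r s"
proof -
  have double: "2 * int (kt n r s) = (\<Sum>i\<in>{1..n}. \<Sum>j\<in>{1..n}. of_bool ((r i < r j) \<noteq> (s i < s j)))"
    if r: "r permutes {1..n}" and s: "s permutes {1..n}" for r s
  proof -
    have "int (kt n r s) = (\<Sum>i\<in>{1..n}. \<Sum>j\<in>{1..n}. of_bool (j < i) * of_bool ((r j < r i) \<noteq> (s j < s i)))"
      unfolding kt_eq_sum by (rule sum.swap)
    then have "2 * int (kt n r s) = (\<Sum>i\<in>{1..n}. \<Sum>j\<in>{1..n}.
        of_bool (i < j) * of_bool ((r i < r j) \<noteq> (s i < s j)) + of_bool (j < i) * of_bool ((r j < r i) \<noteq> (s j < s i)))"
      using kt_eq_sum[of n r s] by (simp only: sum.distrib)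
    also have "\<dots> = (\<Sum>i\<in>{1..n}. \<Sum>j\<in>{1..n}. of_bool ((r i < r j) \<noteq> (s i < s j)))"
    proof (intro sum.cong refl)
      fix i j
      show "of_bool (i < j) * of_bool ((r i < r j) \<noteq> (s i < s j)) + of_bool (j < i) * of_bool ((r j < r i) \<noteq> (s j < s i))
        = (of_bool ((r i < r j) \<noteq> (s i < s j)) :: int)"
        using permutes_less_or[OF r, of i j] permutes_less_or[OF s, of i j]
        by (cases "i < j"; cases "j < i") auto
    qed
    finally show ?thesis .
  qed
  have "2 * int (kt n (r \<circ> t) (s \<circ> t)) = 2 * int (kt n r s)"
    unfolding double[OF r s] double[OF permutes_compose[OF t r] permutes_compose[OF t s]]
    by (subst (3) sum.permute[OF t], subst (4) sum.permute[OF t]) (simp add: o_def)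
  then show ?thesis by simp
qed

lemma kendall_tau_eq_kt: "kendall_tau n \<pi> \<sigma> = kt n (inv \<pi>) (inv \<sigma>)"
  by (simp add: kendall_tau_def kt_def)

lemma kt_id:
  assumes "\<rho> permutes {1..n}" shows "kt n \<rho> id = inversions n \<rho>"
proof -
  have "{(i, j). i \<in> {1..n} \<and> j \<in> {1..n} \<and> i < j \<and> (\<rho> i < \<rho> j) \<noteq> (id i < id j)} =
    {(a, b). a \<in> {1..n} \<and> b \<in> {1..n} \<and> a < b \<and> \<rho> b < \<rho> a}"
    by (auto dest: permutes_less_or[OF assms, OF less_imp_neq])
  then show ?thesis by (simp only: kt_def inversions_def)
qed

text \<open>Pairs ordered alike by \<open>y\<close> and \<open>id\<close> cancel. On a discordant
  pair \<rho> disagrees with exactly one of the two, which leaves a sign.\<close>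

lemma kt_diff_eq_disc_sum:
  assumes y: "y permutes {1..n}"
  shows "real (kt n \<rho> y) - real (kt n \<rho> id) = disc_sum n y \<rho>"
proof -
  define h :: "nat \<times> nat \<Rightarrow> real" where "h x = (if \<rho> (fst x) < \<rho> (snd x) then 1 else -1)" for x
  have "real_of_int (int (kt n \<rho> y)) - real_of_int (int (kt n \<rho> id)) =
     (\<Sum>i\<in>{1..n}. \<Sum>j\<in>{1..n}. if i < j \<and> y j < y i then h (i, j) else 0)"
    unfolding kt_eq_sum of_int_sum sum_subtractf[symmetric]
  proof (intro sum.cong refl)
    fix i j
    show "real_of_int (of_bool (i < j) * of_bool ((\<rho> i < \<rho> j) \<noteq> (y i < y j))) -
        real_of_int (of_bool (i < j) * of_bool ((\<rho> i < \<rho> j) \<noteq> (id i < id j))) =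
        (if i < j \<and> y j < y i then h (i, j) else 0)"
      using permutes_less_or[OF y, of i j]
      by (cases "i < j"; cases "\<rho> i < \<rho> j"; cases "y i < y j") (auto simp: h_def)
  qed
  also have "\<dots> = (\<Sum>x\<in>{1..n}\<times>{1..n}. if fst x < snd x \<and> y (snd x) < y (fst x) then h x else 0)"
    by (simp only: sum.cartesian_product case_prod_unfold prod.collapse)
  also have "\<dots> = (\<Sum>x\<in>{x \<in> {1..n}\<times>{1..n}. fst x < snd x \<and> y (snd x) < y (fst x)}. h x)"
    by (rule sum.inter_filter[symmetric]) simp
  also have "{x \<in> {1..n}\<times>{1..n}. fst x < snd x \<and> y (snd x) < y (fst x)} = disc n y"
    unfolding disc_def by auto
  finally show ?thesis by (simp add: disc_sum_def h_def case_prod_unfold id_def)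
qed

lemma sum_permutes_relabel:
  fixes f :: "(nat \<Rightarrow> nat) \<Rightarrow> real"
  assumes t: "t permutes S"
  shows "(\<Sum>\<pi> | \<pi> permutes S. f (inv \<pi> \<circ> t)) = (\<Sum>\<rho> | \<rho> permutes S. f \<rho>)"
proof (rule sum.reindex_bij_witness[of _ "\<lambda>\<rho>. t \<circ> inv \<rho>" "\<lambda>\<pi>. inv \<pi> \<circ> t"])
  fix \<pi> assume "\<pi> \<in> {\<pi>. \<pi> permutes S}"
  then have p: "\<pi> permutes S" by simp
  have "inv (inv \<pi> \<circ> t) = inv t \<circ> \<pi>"
    using permutes_bij[OF t] permutes_bij[OF permutes_inv[OF p]] permutes_bij[OF p]
    by (simp add: o_inv_distrib inv_inv_eq)
  then show "t \<circ> inv (inv \<pi> \<circ> t) = \<pi>" using permutes_inv_o(1)[OF t] by (simp add: o_assoc)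
  show "inv \<pi> \<circ> t \<in> {\<rho>. \<rho> permutes S}" using p t by (simp add: permutes_compose permutes_inv)
next
  fix \<rho> assume "\<rho> \<in> {\<rho>. \<rho> permutes S}"
  then have p: "\<rho> permutes S" by simp
  have "inv (t \<circ> inv \<rho>) = \<rho> \<circ> inv t"
    using permutes_bij[OF t] permutes_bij[OF permutes_inv[OF p]] permutes_bij[OF p]
    by (simp add: o_inv_distrib inv_inv_eq)
  then show "inv (t \<circ> inv \<rho>) \<circ> t = \<rho>" using permutes_inv_o(2)[OF t] by (simp add: o_assoc[symmetric])
  show "t \<circ> inv \<rho> \<in> {\<pi>. \<pi> permutes S}" using p t by (simp add: permutes_compose permutes_inv)
qed auto

lemma sqdist_eq_pos_vec_dist:
  assumes p: "\<pi>s permutes {1..n}"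
  shows "sqdist n (inv \<sigma>s \<circ> \<pi>s) = (pos_vec_dist n \<pi>s \<sigma>s)\<^sup>2"
proof -
  have "(pos_vec_dist n \<pi>s \<sigma>s)\<^sup>2 = (\<Sum>i\<in>{1..n}. (real (inv \<pi>s i) - real (inv \<sigma>s i))\<^sup>2)"
    unfolding pos_vec_dist_def L2_set_def pos_vec_def by (simp add: sum_nonneg)
  also have "\<dots> = sqdist n (inv \<sigma>s \<circ> \<pi>s)"
    unfolding sqdist_def by (subst sum.permute[OF p]) (simp add: permutes_inverses[OF p])
  finally show ?thesis by simp
qed

lemma pos_vec_dist_nonneg: "pos_vec_dist n \<pi>s \<sigma>s \<ge> 0"
  by (simp add: pos_vec_dist_def L2_set_nonneg)

lemma pos_vec_dist_commute: "pos_vec_dist n \<pi>s \<sigma>s = pos_vec_dist n \<sigma>s \<pi>s"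
  unfolding pos_vec_dist_def L2_set_def by (subst power2_commute) (rule refl)

text \<open>The witness event is the one where \<open>p\<close> dominates \<open>q\<close>. As the
  differences sum to zero, adding them to their absolute values leaves twice the positive
  part.\<close>

lemma sum_abs_diff_pmf_le_tv_dist:
  assumes "finite S" "set_pmf p \<subseteq> S" "set_pmf q \<subseteq> S"
  shows "(\<Sum>x\<in>S. \<bar>pmf p x - pmf q x\<bar>) \<le> 2 * tv_dist p q"
proof -
  define A where "A = {x \<in> S. pmf q x \<le> pmf p x}"
  have fin: "finite A" using assms by (simp add: A_def)
  have "(\<Sum>x\<in>S. pmf p x - pmf q x) = 0" using assms by (simp add: sum_subtractf sum_pmf_eq_1)
  then have "(\<Sum>x\<in>S. \<bar>pmf p x - pmf q x\<bar>) = (\<Sum>x\<in>S. \<bar>pmf p x - pmf q x\<bar> + (pmf p x - pmf q x))"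
    by (simp add: sum.distrib)
  also have "\<dots> = (\<Sum>x\<in>S. if pmf q x \<le> pmf p x then 2 * (pmf p x - pmf q x) else 0)"
    by (intro sum.cong) auto
  also have "\<dots> = (\<Sum>x\<in>A. 2 * (pmf p x - pmf q x))"
    unfolding A_def by (rule sum.inter_filter[symmetric]) (rule assms)
  also have "\<dots> = 2 * (measure_pmf.prob p A - measure_pmf.prob q A)"
    using fin by (simp add: measure_measure_pmf_finite sum_subtractf flip: sum_distrib_left)
  also have "\<dots> \<le> 2 * \<bar>measure_pmf.prob p A - measure_pmf.prob q A\<bar>"
    by (intro mult_left_mono abs_ge_self) simp
  also have "\<dots> \<le> 2 * tv_dist p q"
    unfolding tv_dist_def by (intro mult_left_mono cSUP_upper bdd_above_tv_dist) auto
  finally show ?thesis .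
qed

section \<open>From moments to total variation\<close>

context subunit
begin

text \<open>The substitution \<open>\<rho> = inv \<pi> \<circ> \<pi>s\<close> moves the centre to
  the identity, turning the Kendall-tau distance into the inversion number and \<open>T\<close> into
  \<open>disc_sum\<close>. The normaliser is thus the same for every centre.\<close>

lemma mallows_moments:
  assumes p: "\<pi>s permutes {1..n}" and s: "\<sigma>s permutes {1..n}"
    and small: "(1 - \<phi>) * pos_vec_dist n \<pi>s \<sigma>s \<le> 1 / 2"
  defines "T \<equiv> \<lambda>\<pi>. real (kendall_tau n \<pi> \<sigma>s) - real (kendall_tau n \<pi> \<pi>s)"
  defines "f \<equiv> pmf (mallows n \<phi> \<pi>s)"
  shows "mallows_Z n \<phi> \<pi>s = inv_Z n"
    and "(\<Sum>\<pi> | \<pi> permutes {1..n}. f \<pi> * T \<pi>) \<ge> (1 - \<phi>) * (pos_vec_dist n \<pi>s \<sigma>s)\<^sup>2 / 18"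
    and "(\<Sum>\<pi> | \<pi> permutes {1..n}. f \<pi> * (T \<pi> - (\<Sum>\<pi> | \<pi> permutes {1..n}. f \<pi> * T \<pi>)) ^ 4)
       \<le> 4 * (134136 * (pos_vec_dist n \<pi>s \<sigma>s)\<^sup>2)\<^sup>2"
proof -
  define D where "D = pos_vec_dist n \<pi>s \<sigma>s"
  define y where "y = inv \<sigma>s \<circ> \<pi>s"
  have y: "y permutes {1..n}" using p s by (simp add: y_def permutes_compose permutes_inv)
  have sq: "sqdist n y = D\<^sup>2" using sqdist_eq_pos_vec_dist[OF p] by (simp add: y_def D_def)
  have small': "(1 - \<phi>) * sqrt (sqdist n y) \<le> 1 / 2"
    using small pos_vec_dist_nonneg[of n \<pi>s \<sigma>s] by (simp add: sq D_def)
  have rel: "kendall_tau n \<pi> \<pi>s = inversions n (inv \<pi> \<circ> \<pi>s)" "T \<pi> = disc_sum n y (inv \<pi> \<circ> \<pi>s)"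
    if "\<pi> permutes {1..n}" for \<pi>
  proof -
    have r: "inv \<pi> \<circ> \<pi>s permutes {1..n}" using that p by (simp add: permutes_compose permutes_inv)
    have 1: "kendall_tau n \<pi> \<pi>s = kt n (inv \<pi> \<circ> \<pi>s) id"
      unfolding kendall_tau_eq_kt
      using kt_compose[OF permutes_inv[OF that] permutes_inv[OF p] p] permutes_inv_o(2)[OF p] by simp
    then show "kendall_tau n \<pi> \<pi>s = inversions n (inv \<pi> \<circ> \<pi>s)" using kt_id[OF r] by simp
    have "kendall_tau n \<pi> \<sigma>s = kt n (inv \<pi> \<circ> \<pi>s) y"
      unfolding kendall_tau_eq_kt y_def
      using kt_compose[OF permutes_inv[OF that] permutes_inv[OF s] p] by simp
    with 1 show "T \<pi> = disc_sum n y (inv \<pi> \<circ> \<pi>s)"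
      unfolding T_def using kt_diff_eq_disc_sum[OF y, of "inv \<pi> \<circ> \<pi>s"] by simp
  qed
  have "mallows_Z n \<phi> \<pi>s = (\<Sum>\<pi> | \<pi> permutes {1..n}. \<phi> ^ inversions n (inv \<pi> \<circ> \<pi>s))"
    unfolding mallows_Z_def using rel(1) by (intro sum.cong refl) simp
  also have "\<dots> = inv_Z n" unfolding inv_Z_def by (rule sum_permutes_relabel[OF p])
  finally show ZZ: "mallows_Z n \<phi> \<pi>s = inv_Z n" .
  have Zpos: "inv_Z n > 0" using mallows_Z_pos[OF phi_nonneg p] ZZ by simp
  \<comment> \<open>Transfer for an arbitrary function of \<open>T\<close>; it serves for the mean
    and for the centred fourth power.\<close>
  have E: "(\<Sum>\<pi> | \<pi> permutes {1..n}. f \<pi> * g (T \<pi>)) =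
      (\<Sum>\<rho> | \<rho> permutes {1..n}. \<phi> ^ inversions n \<rho> * g (disc_sum n y \<rho>)) / inv_Z n" for g
  proof -
    have "(\<Sum>\<pi> | \<pi> permutes {1..n}. f \<pi> * g (T \<pi>)) =
        (\<Sum>\<pi> | \<pi> permutes {1..n}.
          \<phi> ^ inversions n (inv \<pi> \<circ> \<pi>s) * g (disc_sum n y (inv \<pi> \<circ> \<pi>s)) / inv_Z n)"
      using rel by (intro sum.cong refl) (simp add: f_def pmf_mallows[OF phi_nonneg p] ZZ)
    also have "\<dots> = (\<Sum>\<rho> | \<rho> permutes {1..n}. \<phi> ^ inversions n \<rho> * g (disc_sum n y \<rho>) / inv_Z n)"
      by (rule sum_permutes_relabel[OF p])
    finally show ?thesis by (simp add: sum_divide_distrib)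
  qed
  obtain m where m: "(\<Sum>\<rho> | \<rho> permutes {1..n}. \<phi> ^ inversions n \<rho> * disc_sum n y \<rho>) = inv_Z n * m"
    "(\<Sum>\<rho> | \<rho> permutes {1..n}. \<phi> ^ inversions n \<rho> * (disc_sum n y \<rho> - m) ^ 4)
        \<le> inv_Z n * (4 * (134136 * sqdist n y)\<^sup>2)"
    using disc_sum_moments[OF small'] by blast
  have mean: "(\<Sum>\<pi> | \<pi> permutes {1..n}. f \<pi> * T \<pi>) = m"
    using E[of "\<lambda>x. x"] m(1) Zpos by simp
  have "inv_Z n * ((1 - \<phi>) * sqdist n y / 18) \<le> inv_Z n * m"
    using disc_sum_mean_ge[OF y small'] unfolding m(1) .
  then have "(1 - \<phi>) * (pos_vec_dist n \<pi>s \<sigma>s)\<^sup>2 / 18 \<le> m"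
    using Zpos by (simp add: sq D_def)
  then show "(\<Sum>\<pi> | \<pi> permutes {1..n}. f \<pi> * T \<pi>) \<ge> (1 - \<phi>) * (pos_vec_dist n \<pi>s \<sigma>s)\<^sup>2 / 18"
    by (simp only: mean)
  have "(\<Sum>\<pi> | \<pi> permutes {1..n}. f \<pi> * (T \<pi> - m) ^ 4) =
      (\<Sum>\<rho> | \<rho> permutes {1..n}. \<phi> ^ inversions n \<rho> * (disc_sum n y \<rho> - m) ^ 4) / inv_Z n"
    by (rule E)
  also have "\<dots> \<le> 4 * (134136 * (pos_vec_dist n \<pi>s \<sigma>s)\<^sup>2)\<^sup>2"
    using m(2) Zpos unfolding sq D_def by (simp only: pos_divide_le_eq mult.commute)
  finally show "(\<Sum>\<pi> | \<pi> permutes {1..n}. f \<pi> * (T \<pi> - (\<Sum>\<pi> | \<pi> permutes {1..n}. f \<pi> * T \<pi>)) ^ 4)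
       \<le> 4 * (134136 * (pos_vec_dist n \<pi>s \<sigma>s)\<^sup>2)\<^sup>2"
    by (simp only: mean)
qed

text \<open>For a \<le> b the difference is \<open>\<phi> ^ a * (1 - \<phi> ^ (b - a))\<close>, and
  \<open>\<phi> ^ a\<close> lies between half the sum of the two powers and the sum.\<close>

lemma abs_diff_power_bounds:
  fixes a b :: nat
  defines "t \<equiv> \<bar>real b - real a\<bar>"
  shows "\<bar>\<phi> ^ a - \<phi> ^ b\<bar> \<le> (\<phi> ^ a + \<phi> ^ b) * ((1 - \<phi>) * t)"
    and "\<bar>\<phi> ^ a - \<phi> ^ b\<bar> \<ge> (\<phi> ^ a + \<phi> ^ b) / 2 * ((1 - \<phi>) * t / (1 + (1 - \<phi>) * t))"
proof -
  have *: "\<bar>\<phi> ^ a - \<phi> ^ b\<bar> \<le> (\<phi> ^ a + \<phi> ^ b) * ((1 - \<phi>) * t) \<and>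
      \<bar>\<phi> ^ a - \<phi> ^ b\<bar> \<ge> (\<phi> ^ a + \<phi> ^ b) / 2 * ((1 - \<phi>) * t / (1 + (1 - \<phi>) * t))"
    if "a \<le> b" "t = \<bar>real b - real a\<bar>" for a b t
  proof -
    define k where "k = b - a"
    have k: "b = a + k" using that by (simp add: k_def)
    have t: "t = real k" using that k by simp
    have pb: "\<phi> ^ b = \<phi> ^ a * \<phi> ^ k" by (simp add: k power_add)
    have le1: "\<phi> ^ k \<le> 1" using phi_nonneg phi_less_1 by (simp add: power_le_one)
    have nn: "0 \<le> \<phi> ^ a" "0 \<le> \<phi> ^ k" using phi_nonneg by auto
    have le: "\<phi> ^ b \<le> \<phi> ^ a" unfolding pb using le1 nn by (simp add: mult_left_le)
    have eq: "\<bar>\<phi> ^ a - \<phi> ^ b\<bar> = \<phi> ^ a * (1 - \<phi> ^ k)" using le pb by (simp add: right_diff_distrib)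
    have "\<phi> ^ a * (1 - \<phi> ^ k) \<le> \<phi> ^ a * ((1 - \<phi>) * t)"
      unfolding t using nn by (intro mult_left_mono one_minus_power_le) auto
    also have "\<dots> \<le> (\<phi> ^ a + \<phi> ^ b) * ((1 - \<phi>) * t)"
      using phi_less_1 phi_nonneg by (intro mult_right_mono) (auto simp: t)
    finally have 1: "\<phi> ^ a * (1 - \<phi> ^ k) \<le> (\<phi> ^ a + \<phi> ^ b) * ((1 - \<phi>) * t)" .
    have "(\<phi> ^ a + \<phi> ^ b) / 2 * ((1 - \<phi>) * t / (1 + (1 - \<phi>) * t)) \<le> \<phi> ^ a * ((1 - \<phi>) * t / (1 + (1 - \<phi>) * t))"
      using le phi_less_1 by (intro mult_right_mono divide_nonneg_nonneg) (auto simp: t)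
    also have "\<dots> \<le> \<phi> ^ a * (1 - \<phi> ^ k)"
      unfolding t using nn by (intro mult_left_mono one_minus_power_ge) auto
    finally show ?thesis using 1 eq by simp
  qed
  show "\<bar>\<phi> ^ a - \<phi> ^ b\<bar> \<le> (\<phi> ^ a + \<phi> ^ b) * ((1 - \<phi>) * t)"
    "\<bar>\<phi> ^ a - \<phi> ^ b\<bar> \<ge> (\<phi> ^ a + \<phi> ^ b) / 2 * ((1 - \<phi>) * t / (1 + (1 - \<phi>) * t))"
    using *[of a b t] *[of b a t] by (cases "a \<le> b"; simp add: t_def add.commute[of "\<phi> ^ b"]
        abs_minus_commute[of "real a"] abs_minus_commute[of "\<phi> ^ b"])+
qed

end

text \<open>A polynomial minorant that replaces the saturated function by second and fourth powers.
  Up to \<open>L\<close> the quadratic term is below \<open>u\<close>; beyond \<open>L\<close> the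
  minorant is negative.\<close>

lemma saturated_linear_ge_quartic:
  fixes u L \<delta> :: real
  assumes "u \<ge> 0" "L > 0" "\<delta> \<ge> 0"
  shows "u / (1 + \<delta> * u) \<ge> (u\<^sup>2 / L - u ^ 4 / L ^ 3) / (1 + \<delta> * L)"
proof (cases "u \<le> L")
  case True
  have "(u\<^sup>2 / L - u ^ 4 / L ^ 3) / (1 + \<delta> * L) \<le> u / (1 + \<delta> * L)"
  proof (intro divide_right_mono)
    have "u\<^sup>2 / L \<le> u" using True assms by (simp add: power2_eq_square divide_le_eq mult_left_mono)
    moreover have "0 \<le> u ^ 4 / L ^ 3" using assms by simp
    ultimately show "u\<^sup>2 / L - u ^ 4 / L ^ 3 \<le> u" by linarith
  qed (use assms in auto)
  also have "\<dots> \<le> u / (1 + \<delta> * u)"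
    using True assms by (intro divide_left_mono mult_pos_pos add_pos_nonneg) (auto intro: mult_left_mono)
  finally show ?thesis .
next
  case False
  have "u\<^sup>2 / L - u ^ 4 / L ^ 3 = u\<^sup>2 / L ^ 3 * (L\<^sup>2 - u\<^sup>2)"
    using assms by (simp add: field_simps power2_eq_square power3_eq_cube power4_eq_xxxx)
  also have "\<dots> \<le> 0" using False assms by (intro mult_nonneg_nonpos) (auto simp: power_mono)
  finally have "(u\<^sup>2 / L - u ^ 4 / L ^ 3) / (1 + \<delta> * L) \<le> 0"
    using assms by (intro divide_nonpos_nonneg) auto
  also have "0 \<le> u / (1 + \<delta> * u)" using assms by simp
  finally show ?thesis .
qed

text \<open>(x + y)^4 \<le> 8 x^4 + 8 y^4 with x = T - m and y = m, and m^2 is at most the second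
  moment because the variance is nonnegative.\<close>

lemma fourth_moment_le:
  fixes f T :: "'a \<Rightarrow> real"
  assumes "finite S" "\<And>x. x \<in> S \<Longrightarrow> f x \<ge> 0" "sum f S = 1"
  defines "m \<equiv> \<Sum>x\<in>S. f x * T x"
  shows "(\<Sum>x\<in>S. f x * T x ^ 4) \<le> 8 * (\<Sum>x\<in>S. f x * (T x - m) ^ 4) + 8 * (\<Sum>x\<in>S. f x * (T x)\<^sup>2)\<^sup>2"
proof -
  have "(\<Sum>x\<in>S. f x * T x ^ 4) \<le> (\<Sum>x\<in>S. 8 * (f x * (T x - m) ^ 4) + 8 * m ^ 4 * f x)"
  proof (rule sum_mono)
    fix x assume x: "x \<in> S"
    have sq: "(a + b)\<^sup>2 \<le> 2 * a\<^sup>2 + 2 * b\<^sup>2" for a b :: real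
      using sum_squares_bound[of a b] by (simp add: power2_sum)
    have "(T x)\<^sup>2 \<le> 2 * (T x - m)\<^sup>2 + 2 * m\<^sup>2" using sq[of "T x - m" m] by simp
    then have "((T x)\<^sup>2)\<^sup>2 \<le> (2 * (T x - m)\<^sup>2 + 2 * m\<^sup>2)\<^sup>2" by (rule power_mono) simp
    also have "\<dots> \<le> 2 * (2 * (T x - m)\<^sup>2)\<^sup>2 + 2 * (2 * m\<^sup>2)\<^sup>2" by (rule sq)
    finally have "T x ^ 4 \<le> 8 * (T x - m) ^ 4 + 8 * m ^ 4" by (simp add: power_mult_distrib)
    from mult_left_mono[OF this assms(2)[OF x]]
    show "f x * T x ^ 4 \<le> 8 * (f x * (T x - m) ^ 4) + 8 * m ^ 4 * f x" by (simp add: algebra_simps)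
  qed
  also have "\<dots> = 8 * (\<Sum>x\<in>S. f x * (T x - m) ^ 4) + 8 * m ^ 4"
    using assms(3) by (simp add: sum.distrib flip: sum_distrib_left)
  also have "m ^ 4 \<le> (\<Sum>x\<in>S. f x * (T x)\<^sup>2)\<^sup>2"
  proof -
    have "0 \<le> (\<Sum>x\<in>S. f x * (T x - m)\<^sup>2)" using assms(2) by (intro sum_nonneg) auto
    also have "\<dots> = (\<Sum>x\<in>S. f x * (T x)\<^sup>2 - 2 * m * (f x * T x) + m\<^sup>2 * f x)"
      by (intro sum.cong refl) (simp add: power2_eq_square algebra_simps)
    also have "\<dots> = (\<Sum>x\<in>S. f x * (T x)\<^sup>2) - 2 * m * m + m\<^sup>2 * 1"
      unfolding sum.distrib sum_subtractf sum_distrib_left[symmetric] assms(3) m_def ..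
    finally have "m\<^sup>2 \<le> (\<Sum>x\<in>S. f x * (T x)\<^sup>2)" by (simp add: power2_eq_square)
    then have "(m\<^sup>2)\<^sup>2 \<le> (\<Sum>x\<in>S. f x * (T x)\<^sup>2)\<^sup>2" by (rule power_mono) simp
    then show ?thesis by simp
  qed
  finally show ?thesis by simp
qed

context subunit
begin

text \<open>Up to constants the total variation dominates the sum of \<delta>|T| / (1 + \<delta>|T|)
  with weights \<mu> = f + g. The minorant \<open>saturated_linear_ge_quartic\<close> bounds it
  below by \<open>S2\<close> and \<open>S4\<close>, and \<open>S4 \<le> B * S2\<^sup>2\<close> keeps
  the fourth moment term small.\<close>

lemma mallows_tv_dist_ge:
  assumes p: "\<pi>s permutes {1..n}" and s: "\<sigma>s permutes {1..n}"
    and small: "(1 - \<phi>) * pos_vec_dist n \<pi>s \<sigma>s \<le> 1 / 2"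
  defines "B \<equiv> 5184 * 134136\<^sup>2 + 8"
  shows "tv_dist (mallows n \<phi> \<pi>s) (mallows n \<phi> \<sigma>s) \<ge> (1 - \<phi>) * pos_vec_dist n \<pi>s \<sigma>s / (24 * B)"
proof -
  define S where "S = {\<pi>. \<pi> permutes {1..n}}"
  define \<delta> where "\<delta> = 1 - \<phi>"
  define D where "D = pos_vec_dist n \<pi>s \<sigma>s"
  define K :: real where "K = 134136"
  define f g where "f = pmf (mallows n \<phi> \<pi>s)" and "g = pmf (mallows n \<phi> \<sigma>s)"
  define T where "T \<pi> = real (kendall_tau n \<pi> \<sigma>s) - real (kendall_tau n \<pi> \<pi>s)" for \<pi>
  have \<delta>: "\<delta> > 0" using phi_less_1 by (simp add: \<delta>_def)
  have fin: "finite S" unfolding S_def by (rule finite_permutations) simp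
  have sub: "set_pmf (mallows n \<phi> \<pi>s) \<subseteq> S" "set_pmf (mallows n \<phi> \<sigma>s) \<subseteq> S"
    by (auto simp: S_def set_pmf_iff pmf_mallows[OF phi_nonneg p] pmf_mallows[OF phi_nonneg s] split: if_splits)
  have nn: "f \<pi> \<ge> 0" "g \<pi> \<ge> 0" for \<pi> by (auto simp: f_def g_def)
  have one: "sum f S = 1" "sum g S = 1" using sub fin by (auto simp: f_def g_def sum_pmf_eq_1)
  note M1 = mallows_moments[OF p s small, folded T_def f_def S_def]
  have small': "(1 - \<phi>) * pos_vec_dist n \<sigma>s \<pi>s \<le> 1 / 2" using small by (simp add: pos_vec_dist_commute)
  \<comment> \<open>Exchanging the two centres replaces \<open>T\<close> by its negative and keeps
    the distance.\<close>
  note M2 = mallows_moments[OF s p small', folded g_def S_def]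
  have T': "real (kendall_tau n \<pi> \<pi>s) - real (kendall_tau n \<pi> \<sigma>s) = - T \<pi>" for \<pi> by (simp add: T_def)
  have D': "pos_vec_dist n \<sigma>s \<pi>s = D" by (simp add: D_def pos_vec_dist_commute)
  define m m' where "m = (\<Sum>\<pi>\<in>S. f \<pi> * T \<pi>)" and "m' = (\<Sum>\<pi>\<in>S. g \<pi> * T \<pi>)"
  have mf: "m \<ge> \<delta> * D\<^sup>2 / 18" "(\<Sum>\<pi>\<in>S. f \<pi> * (T \<pi> - m) ^ 4) \<le> 4 * (K * D\<^sup>2)\<^sup>2"
    using M1(2,3) by (simp_all add: m_def \<delta>_def D_def K_def)
  have neg: "(\<Sum>\<pi>\<in>S. g \<pi> * - T \<pi>) = - m'" by (simp add: m'_def sum_negf)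
  have "- m' \<ge> \<delta> * D\<^sup>2 / 18" using M2(2) unfolding T' D' neg \<delta>_def .
  then have mg1: "m' \<le> - (\<delta> * D\<^sup>2 / 18)" by linarith
  have mg2: "(\<Sum>\<pi>\<in>S. g \<pi> * (T \<pi> - m') ^ 4) \<le> 4 * (K * D\<^sup>2)\<^sup>2"
  proof -
    have "(- T \<pi> - - m') ^ 4 = (T \<pi> - m') ^ 4" for \<pi>
      using power_minus_even[of 4 "T \<pi> - m'"] by simp
    then show ?thesis using M2(3) unfolding T' D' neg K_def by simp
  qed
  define \<mu> where "\<mu> \<pi> = f \<pi> + g \<pi>" for \<pi>
  have \<mu>: "\<mu> \<pi> \<ge> 0" for \<pi> using nn[of \<pi>] by (simp add: \<mu>_def)
  have pw: "\<bar>f \<pi> - g \<pi>\<bar> \<le> \<mu> \<pi> * (\<delta> * \<bar>T \<pi>\<bar>)"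
    "\<bar>f \<pi> - g \<pi>\<bar> \<ge> \<mu> \<pi> / 2 * (\<delta> * \<bar>T \<pi>\<bar> / (1 + \<delta> * \<bar>T \<pi>\<bar>))" if "\<pi> \<in> S" for \<pi>
  proof -
    have Zpos: "inv_Z n > 0" using mallows_Z_pos[OF phi_nonneg p] M1(1) by simp
    let ?a = "kendall_tau n \<pi> \<pi>s" and ?b = "kendall_tau n \<pi> \<sigma>s"
    have fg: "f \<pi> = \<phi> ^ ?a / inv_Z n" "g \<pi> = \<phi> ^ ?b / inv_Z n"
      using that M1(1) M2(1) by (simp_all add: f_def g_def S_def pmf_mallows[OF phi_nonneg p] pmf_mallows[OF phi_nonneg s])
    have d: "\<bar>f \<pi> - g \<pi>\<bar> = \<bar>\<phi> ^ ?a - \<phi> ^ ?b\<bar> / inv_Z n" "\<mu> \<pi> = (\<phi> ^ ?a + \<phi> ^ ?b) / inv_Z n"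
      using Zpos by (simp_all add: fg \<mu>_def add_divide_distrib flip: diff_divide_distrib)
    note A = divide_right_mono[OF abs_diff_power_bounds(1)[of ?a ?b], of "inv_Z n"]
      divide_right_mono[OF abs_diff_power_bounds(2)[of ?a ?b], of "inv_Z n"]
    show "\<bar>f \<pi> - g \<pi>\<bar> \<le> \<mu> \<pi> * (\<delta> * \<bar>T \<pi>\<bar>)"
      using A(1) Zpos unfolding d \<delta>_def T_def by simp
    show "\<bar>f \<pi> - g \<pi>\<bar> \<ge> \<mu> \<pi> / 2 * (\<delta> * \<bar>T \<pi>\<bar> / (1 + \<delta> * \<bar>T \<pi>\<bar>))"
    proof -
      have "x / 2 * y / inv_Z n = x / inv_Z n / 2 * y" for x y :: real by simp
      then show ?thesis using A(2) Zpos unfolding d \<delta>_def T_def by (simp only: less_imp_le)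
    qed
  qed
  define S2 S4 where "S2 = (\<Sum>\<pi>\<in>S. \<mu> \<pi> * (T \<pi>)\<^sup>2)" and "S4 = (\<Sum>\<pi>\<in>S. \<mu> \<pi> * T \<pi> ^ 4)"
  have S2_split: "S2 = (\<Sum>\<pi>\<in>S. f \<pi> * (T \<pi>)\<^sup>2) + (\<Sum>\<pi>\<in>S. g \<pi> * (T \<pi>)\<^sup>2)"
    by (simp add: S2_def \<mu>_def distrib_right sum.distrib)
  have S2_ge: "S2 \<ge> D\<^sup>2 / 9"
  proof -
    have "\<delta> * (D\<^sup>2 / 9) \<le> m - m'" using mf(1) mg1 by simp
    also have "\<dots> = (\<Sum>\<pi>\<in>S. (f \<pi> - g \<pi>) * T \<pi>)" by (simp add: m_def m'_def left_diff_distrib sum_subtractf)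
    also have "\<dots> \<le> (\<Sum>\<pi>\<in>S. \<delta> * (\<mu> \<pi> * (T \<pi>)\<^sup>2))"
    proof (rule sum_mono)
      fix \<pi> assume \<pi>: "\<pi> \<in> S"
      have "(f \<pi> - g \<pi>) * T \<pi> \<le> \<bar>f \<pi> - g \<pi>\<bar> * \<bar>T \<pi>\<bar>" by (metis abs_ge_self abs_mult)
      also have "\<dots> \<le> \<mu> \<pi> * (\<delta> * \<bar>T \<pi>\<bar>) * \<bar>T \<pi>\<bar>" by (intro mult_right_mono pw[OF \<pi>]) simp
      also have "\<dots> = \<delta> * (\<mu> \<pi> * (T \<pi>)\<^sup>2)" by (simp add: power2_eq_square)
      finally show "(f \<pi> - g \<pi>) * T \<pi> \<le> \<delta> * (\<mu> \<pi> * (T \<pi>)\<^sup>2)" .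
    qed
    also have "\<dots> = \<delta> * S2" by (simp add: S2_def sum_distrib_left)
    finally show ?thesis using \<delta> by simp
  qed
  have S4_le: "S4 \<le> B * S2\<^sup>2"
  proof -
    let ?a = "\<Sum>\<pi>\<in>S. f \<pi> * (T \<pi>)\<^sup>2" and ?b = "\<Sum>\<pi>\<in>S. g \<pi> * (T \<pi>)\<^sup>2"
    have ab: "?a \<ge> 0" "?b \<ge> 0" using nn by (auto intro!: sum_nonneg)
    have "S4 = (\<Sum>\<pi>\<in>S. f \<pi> * T \<pi> ^ 4) + (\<Sum>\<pi>\<in>S. g \<pi> * T \<pi> ^ 4)"
      by (simp add: S4_def \<mu>_def distrib_right sum.distrib)
    also have "\<dots> \<le> (8 * (4 * (K * D\<^sup>2)\<^sup>2) + 8 * ?a\<^sup>2) + (8 * (4 * (K * D\<^sup>2)\<^sup>2) + 8 * ?b\<^sup>2)"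
      using fourth_moment_le[of S f T, folded m_def] fourth_moment_le[of S g T, folded m'_def] fin nn one mf(2) mg2
      by (intro add_mono) fastforce+
    also have "\<dots> = 64 * K\<^sup>2 * (D\<^sup>2)\<^sup>2 + 8 * (?a\<^sup>2 + ?b\<^sup>2)" by (simp add: power_mult_distrib)
    \<comment> \<open>\<open>D\<^sup>2 \<le> 9 * S2\<close> eliminates \<open>D\<close>; 64 * 81 =
      5184 is the constant in \<open>B\<close>.\<close>
    also have "\<dots> \<le> 64 * K\<^sup>2 * (81 * S2\<^sup>2) + 8 * S2\<^sup>2"
    proof (intro add_mono mult_left_mono)
      have "(D\<^sup>2)\<^sup>2 \<le> (9 * S2)\<^sup>2" using S2_ge by (intro power_mono) auto
      then show "(D\<^sup>2)\<^sup>2 \<le> 81 * S2\<^sup>2" by (simp add: power_mult_distrib)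
      show "?a\<^sup>2 + ?b\<^sup>2 \<le> S2\<^sup>2" unfolding S2_split power2_sum using ab by simp
    qed (auto simp: K_def)
    also have "\<dots> = B * S2\<^sup>2" by (simp add: B_def K_def)
    finally show ?thesis .
  qed
  show ?thesis
  \<comment> \<open>For \<open>D = 0\<close> the claim is trivial; otherwise \<open>S2\<close> is
    positive and can be divided by.\<close>
  proof (cases "D = 0")
    case True
    have "0 \<le> (\<Sum>x\<in>S. \<bar>f x - g x\<bar>)" by (simp add: sum_nonneg)
    also have "\<dots> \<le> 2 * tv_dist (mallows n \<phi> \<pi>s) (mallows n \<phi> \<sigma>s)"
      unfolding f_def g_def by (rule sum_abs_diff_pmf_le_tv_dist[OF fin sub])
    finally show ?thesis using True by (simp add: D_def)
  next
    case False
    then have D: "D > 0" using pos_vec_dist_nonneg[of n \<pi>s \<sigma>s] by (simp add: D_def)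
    have Bpos: "B > 0" "B \<ge> 9" by (auto simp: B_def)
    \<comment> \<open>With this \<open>L\<close> the fourth moment term costs at most half of
      \<open>S2 / L\<close>, leaving \<open>L / (4 * B)\<close>.\<close>
    define L where "L = sqrt (2 * B * S2)"
    have S2pos: "S2 > 0" using S2_ge D by (smt (verit) divide_pos_pos zero_less_power)
    have Lpos: "L > 0" using S2pos Bpos by (simp add: L_def)
    have L2: "L\<^sup>2 = 2 * B * S2" using S2pos Bpos by (simp add: L_def)
    have DL: "D \<le> L"
    proof (rule power2_le_imp_le)
      have "D\<^sup>2 \<le> 9 * S2" using S2_ge by simp
      also have "\<dots> \<le> 2 * B * S2" using S2pos Bpos by (intro mult_right_mono) auto
      finally show "D\<^sup>2 \<le> L\<^sup>2" using L2 by simp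
    qed (use Lpos in simp)
    have dL: "1 + \<delta> * L > 0" using \<delta> Lpos by (simp add: add_pos_pos)
    have "\<delta> * D / (12 * B) \<le> \<delta> / 2 * (L / (4 * B) / (1 + \<delta> * L))"
    proof -
      \<comment> \<open>This is where \<delta> D \<le> 1/2 enters. As x / (1 + \<delta> x)
        increases, \<open>D\<close> may then be replaced by the larger \<open>L\<close>.\<close>
      have "D / (3 / 2) \<le> D / (1 + \<delta> * D)"
        using D \<delta> small by (intro divide_left_mono) (auto simp: \<delta>_def D_def intro!: mult_pos_pos add_pos_nonneg)
      also have "\<dots> \<le> L / (1 + \<delta> * L)"
        using DL D \<delta> dL by (simp add: divide_le_eq le_divide_eq field_simps add_pos_pos)
      finally have "\<delta> / (8 * B) * (D / (3 / 2)) \<le> \<delta> / (8 * B) * (L / (1 + \<delta> * L))"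
        using \<delta> Bpos by (intro mult_left_mono) auto
      then show ?thesis by (simp add: mult.commute mult.left_commute)
    qed
    also have "\<dots> \<le> \<delta> / 2 * ((S2 / L - S4 / L ^ 3) / (1 + \<delta> * L))"
    proof (intro mult_left_mono divide_right_mono)
      have "S4 / L ^ 3 \<le> B * S2\<^sup>2 / L ^ 3" using S4_le Lpos by (intro divide_right_mono) auto
      moreover have "S2 / L - B * S2\<^sup>2 / L ^ 3 = L / (4 * B)"
      proof -
        have S2: "S2 = L\<^sup>2 / (2 * B)" using L2 Bpos by simp
        show ?thesis
          unfolding S2 using Lpos Bpos by (simp add: field_simps power2_eq_square power3_eq_cube)
      qed
      ultimately show "L / (4 * B) \<le> S2 / L - S4 / L ^ 3" by linarith
    qed (use \<delta> dL in auto)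
    also have "\<dots> = \<delta> / 2 * (\<Sum>\<pi>\<in>S. \<mu> \<pi> * ((\<bar>T \<pi>\<bar>\<^sup>2 / L - \<bar>T \<pi>\<bar> ^ 4 / L ^ 3) / (1 + \<delta> * L)))"
      by (simp add: S2_def S4_def sum_divide_distrib sum_subtractf right_diff_distrib diff_divide_distrib power_even_abs)
    also have "\<dots> \<le> \<delta> / 2 * (\<Sum>\<pi>\<in>S. \<mu> \<pi> * (\<bar>T \<pi>\<bar> / (1 + \<delta> * \<bar>T \<pi>\<bar>)))"
      using \<delta> Lpos \<mu> by (intro mult_left_mono sum_mono saturated_linear_ge_quartic) auto
    also have "\<dots> = (\<Sum>\<pi>\<in>S. \<mu> \<pi> / 2 * (\<delta> * \<bar>T \<pi>\<bar> / (1 + \<delta> * \<bar>T \<pi>\<bar>)))"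
      unfolding sum_distrib_left by (intro sum.cong refl) simp
    also have "\<dots> \<le> (\<Sum>\<pi>\<in>S. \<bar>f \<pi> - g \<pi>\<bar>)" by (intro sum_mono pw)
    also have "\<dots> \<le> 2 * tv_dist (mallows n \<phi> \<pi>s) (mallows n \<phi> \<sigma>s)"
      unfolding f_def g_def by (rule sum_abs_diff_pmf_le_tv_dist[OF fin sub])
    finally show ?thesis by (simp add: \<delta>_def D_def)
  qed
qed

end

theorem theorem4p2:
  shows "\<exists>C::real. C > 0 \<and>
    (\<forall>(n::nat) (\<phi>::real) (\<pi>s::nat \<Rightarrow> nat) (\<sigma>s::nat \<Rightarrow> nat).
       0 \<le> \<phi> \<longrightarrow> \<phi> \<le> 1 \<longrightarrow> \<pi>s permutes {1..n} \<longrightarrow> \<sigma>s permutes {1..n} \<longrightarrow>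
       (\<phi> < 1 \<longrightarrow> pos_vec_dist n \<pi>s \<sigma>s \<le> 1 / (2 * (1 - \<phi>))) \<longrightarrow>
       tv_dist (mallows n \<phi> \<pi>s) (mallows n \<phi> \<sigma>s) \<ge> (1 - \<phi>) * pos_vec_dist n \<pi>s \<sigma>s / C)"
proof (intro exI[of _ "24 * (5184 * 134136\<^sup>2 + 8)"] conjI allI impI)
  fix n :: nat and \<phi> :: real and \<pi>s \<sigma>s :: "nat \<Rightarrow> nat"
  assume \<phi>: "0 \<le> \<phi>" "\<phi> \<le> 1" and p: "\<pi>s permutes {1..n}" and s: "\<sigma>s permutes {1..n}"
    and small: "\<phi> < 1 \<longrightarrow> pos_vec_dist n \<pi>s \<sigma>s \<le> 1 / (2 * (1 - \<phi>))"
  show "tv_dist (mallows n \<phi> \<pi>s) (mallows n \<phi> \<sigma>s) \<ge>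
      (1 - \<phi>) * pos_vec_dist n \<pi>s \<sigma>s / (24 * (5184 * 134136\<^sup>2 + 8))"
  proof (cases "\<phi> < 1")
    case True
    then interpret subunit \<phi> using \<phi> by unfold_locales
    have "(1 - \<phi>) * pos_vec_dist n \<pi>s \<sigma>s \<le> 1 / 2"
      using small True by (simp add: field_simps)
    then show ?thesis by (rule mallows_tv_dist_ge[OF p s])
  next
    \<comment> \<open>For \<phi> = 1 the lower bound is 0, so nonnegativity of the distance
      suffices.\<close>
    case False
    then have "\<phi> = 1" using \<phi> by simp
    have "0 \<le> \<bar>measure_pmf.prob (mallows n \<phi> \<pi>s) {} - measure_pmf.prob (mallows n \<phi> \<sigma>s) {}\<bar>" by simp
    also have "\<dots> \<le> tv_dist (mallows n \<phi> \<pi>s) (mallows n \<phi> \<sigma>s)"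
      unfolding tv_dist_def by (intro cSUP_upper bdd_above_tv_dist) simp
    finally show ?thesis using \<open>\<phi> = 1\<close> by simp
  qed
qed simp

end
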